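(* Let $f\in H^2(\mathbb{B})$. The following are equivalent: (i) $f$ is inner; (ii) $\|f\|_{H^2}=\|f\|_{H^\infty}=1$; (iii) $\|f\|_{H^2}=1$ and for all $k\in\mathbb{N}$ and $\lambda\in\mathbb{H}$ we have $$\|(q^k+\lambda)\ast f\|_{H^2}\le\|q^k+\lambda\|_{H^2}.$$
   Context: $\mathbb{H}$ is the skew field of quaternions, $\mathbb{B}=\{q\in\mathbb{H}:|q|<1\}$, $\mathbb{S}=\{q\in\mathbb{H}:q^2=-1\}$; for $I\in\mathbb{S}$, $L_I=\mathbb{R}+\mathbb{R}I\cong\mathbb{C}$ and $\mathbb{B}_I=\mathbb{B}\cap L_I$. $\mathbb{N}$ includes $0$. A function $f:\mathbb{B}\to\mathbb{H}$ is slice regular if, for every $I\in\mathbb{S}$, its restriction $f_I$ to $\mathbb{B}_I$ has continuous partial derivatives and $\frac12(\partial_x+I\partial_y)f_I(x+yI)=0$; equivalently $f(q)=\sum_{n\ge0}q^na_n$ on $\mathbb{B}$ with $a_n\in\mathbb{H}$. $H^2(\mathbb{B})$ is the space of slice regular functions $f(q)=\sum_{n\ge0}q^na_n$ with $\|f\|_{H^2}^2=\sum_{n\ge0}|a_n|^2<\infty$. $H^\infty(\mathbb{B})\subseteq H^2(\mathbb{B})$ is the space of bounded slice regular functions on $\mathbb{B}$, with $\|f\|_{H^\infty}=\sup_{\mathbb{B}}|f|$. The boundary $\partial\mathbb{B}=\{e^{tI}=\cos t+\sin t\,I:I\in\mathbb{S},t\in\mathbb{R}\}$ carries the measure $d\Sigma(e^{tI})=d\sigma(I)\,dt$,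 with $dt$ Lebesgue measure on $[0,2\pi)$ and $d\sigma$ the standard area element of $\mathbb{S}$, normalized so that $\Sigma(\partial\mathbb{B})=1$. Every $f\in H^2(\mathbb{B})$ has boundary values $\Sigma$-a.e. on $\partial\mathbb{B}$, given by radial limits and still denoted $f$. A function $\varphi\in H^\infty(\mathbb{B})$ is inner if $|\varphi(q)|\le1$ on $\mathbb{B}$ and $|\varphi(q)|=1$ for $\Sigma$-a.e. $q\in\partial\mathbb{B}$. The $\ast$-product of $f=\sum q^na_n$ and $g=\sum q^nb_n$ is $f\ast g(q)=\sum_{n\ge0}q^n\sum_{k=0}^na_kb_{n-k}$. *)

theory Defs
  imports "HOL-Analysis.Analysis"
begin

datatype quat = Quat (qRe: real) (qI: real) (qJ: real) (qK: real)

lemma quat_eq_iff: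
  "p = q \<longleftrightarrow> qRe p = qRe q \<and> qI p = qI q \<and> qJ p = qJ q \<and> qK p = qK q"
  by (cases p; cases q) simp

instantiation quat :: real_vector
begin

definition "0 = Quat 0 0 0 0"
definition "p + q = Quat (qRe p + qRe q) (qI p + qI q) (qJ p + qJ q) (qK p + qK q)"
definition "- q = Quat (- qRe q) (- qI q) (- qJ q) (- qK q)"
definition "p - (q::quat) = p + - q"
definition "c *\<^sub>R q = Quat (c * qRe q) (c * qI q) (c * qJ q) (c * qK q)"

instance
  by standard
    (simp_all add: quat_eq_iff zero_quat_def plus_quat_def uminus_quat_def minus_quat_def
      scaleR_quat_def algebra_simps)

end

lemma quat_sel_linear [simp]:
  "qRe 0 = 0" "qI 0 = 0" "qJ 0 = 0" "qK 0 = 0"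
  "qRe (p + q) = qRe p + qRe q" "qI (p + q) = qI p + qI q"
  "qJ (p + q) = qJ p + qJ q" "qK (p + q) = qK p + qK q"
  "qRe (- q) = - qRe q" "qI (- q) = - qI q" "qJ (- q) = - qJ q" "qK (- q) = - qK q"
  "qRe (p - q) = qRe p - qRe q" "qI (p - q) = qI p - qI q"
  "qJ (p - q) = qJ p - qJ q" "qK (p - q) = qK p - qK q"
  "qRe (c *\<^sub>R q) = c * qRe q" "qI (c *\<^sub>R q) = c * qI q"
  "qJ (c *\<^sub>R q) = c * qJ q" "qK (c *\<^sub>R q) = c * qK q"
  by (simp_all add: zero_quat_def plus_quat_def uminus_quat_def minus_quat_def scaleR_quat_def)

instantiation quat :: euclidean_space
begin

definition "inner p q = qRe p * qRe q + qI p * qI q + qJ p * qJ q + qK p * qK q"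
definition "norm q = sqrt ((qRe q)\<^sup>2 + (qI q)\<^sup>2 + (qJ q)\<^sup>2 + (qK q)\<^sup>2)"
definition "sgn (q::quat) = q /\<^sub>R norm q"
definition "dist p (q::quat) = norm (p - q)"
definition "(uniformity :: (quat \<times> quat) filter) = (INF e\<in>{0 <..}. principal {(x, y). dist x y < e})"
definition "open (U :: quat set) \<longleftrightarrow> (\<forall>x\<in>U. eventually (\<lambda>(x', y). x' = x \<longrightarrow> y \<in> U) uniformity)"
definition "Basis = {Quat 1 0 0 0, Quat 0 1 0 0, Quat 0 0 1 0, Quat 0 0 0 1}"

instance
proof
  fix p q r :: quat and c :: real
  show "inner p p = 0 \<longleftrightarrow> p = 0"
    unfolding inner_quat_def quat_eq_iff
    by (smt (verit) mult_eq_0_iff quat_sel_linear(1-4) zero_le_square)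
  show "norm p = sqrt (inner p p)"
    by (simp add: norm_quat_def inner_quat_def power2_eq_square)
  show "inner p q = (if p = q then 1 else 0)" if "p \<in> Basis" "q \<in> Basis"
    using that unfolding Basis_quat_def insert_iff empty_iff
    by (elim disjE FalseE) (simp_all add: inner_quat_def)
  show "(\<forall>u\<in>Basis. inner p u = 0) \<longleftrightarrow> p = 0"
    unfolding Basis_quat_def inner_quat_def quat_eq_iff by simp
  show "Basis \<noteq> ({} :: quat set)" "finite (Basis :: quat set)"
    by (simp_all add: Basis_quat_def)
  show "inner p q = inner q p" "inner (p + q) r = inner p r + inner q r"
    "inner (c *\<^sub>R p) q = c * inner p q" "0 \<le> inner p p"
    by (simp_all add: inner_quat_def algebra_simps)
qed (rule sgn_quat_def dist_quat_def uniformity_quat_def open_quat_def)+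

end

instantiation quat :: real_normed_div_algebra
begin

definition "1 = Quat 1 0 0 0"
definition "p * q = Quat
  (qRe p * qRe q - qI p * qI q - qJ p * qJ q - qK p * qK q)
  (qRe p * qI q + qI p * qRe q + qJ p * qK q - qK p * qJ q)
  (qRe p * qJ q - qI p * qK q + qJ p * qRe q + qK p * qI q)
  (qRe p * qK q + qI p * qJ q - qJ p * qI q + qK p * qRe q)"
definition "inverse q = Quat (qRe q) (- qI q) (- qJ q) (- qK q) /\<^sub>R (norm q)\<^sup>2"
definition "p div (q::quat) = p * inverse q"

instance
proof
  fix p q r :: quat and c :: real
  show "p * q * r = p * (q * r)" "(p + q) * r = p * r + q * r" "p * (q + r) = p * q + p * r"
    "(c *\<^sub>R p) * q = c *\<^sub>R (p * q)" "p * (c *\<^sub>R q) = c *\<^sub>R (p * q)"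
    by (simp_all add: quat_eq_iff times_quat_def algebra_simps)
  show "1 * p = p" "p * 1 = p" "(0::quat) \<noteq> 1"
    by (simp_all add: quat_eq_iff times_quat_def one_quat_def)
  have sq: "(norm q)\<^sup>2 = (qRe q)\<^sup>2 + (qI q)\<^sup>2 + (qJ q)\<^sup>2 + (qK q)\<^sup>2" for q :: quat
    by (simp add: norm_quat_def)
  show "inverse p * p = 1" "p * inverse p = 1" if "p \<noteq> 0"
  proof -
    have "(norm p)\<^sup>2 \<noteq> 0" using that by simp
    then show "inverse p * p = 1" "p * inverse p = 1"
      by (simp_all add: quat_eq_iff times_quat_def one_quat_def inverse_quat_def divide_simps,
          simp_all add: sq [unfolded power2_eq_square] power2_eq_square algebra_simps)
  qed
  show "p div q = p * inverse q" by (rule divide_quat_def)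
  show "inverse (0::quat) = 0" by (simp add: quat_eq_iff inverse_quat_def)
  show "norm (p * q) = norm p * norm q"
    unfolding norm_quat_def real_sqrt_mult [symmetric]
    by (rule arg_cong [where f = sqrt])
      (simp add: times_quat_def power2_eq_square algebra_simps)
qed

end

abbreviation quat_ball :: "quat set" (\<open>\<bool>\<close>)
  where "\<bool> \<equiv> ball 0 1"

definition imag_units :: "quat set"
  where "imag_units = {q. q\<^sup>2 = - 1}"

text \<open>Functions on the open unit ball are total functions of which only the values on the
  ball matter.\<close>

definition slice_regular :: "(quat \<Rightarrow> quat) \<Rightarrow> bool" where
  "slice_regular f \<longleftrightarrow>
    (\<forall>I\<in>imag_units. \<exists>fx fy :: real \<times> real \<Rightarrow> quat.
      let D = {(x, y). of_real x + of_real y * I \<in> \<bool>} in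
        continuous_on D fx \<and> continuous_on D fy \<and>
        (\<forall>(x, y)\<in>D.
          ((\<lambda>s. f (of_real s + of_real y * I)) has_vector_derivative fx (x, y)) (at x) \<and>
          ((\<lambda>s. f (of_real x + of_real s * I)) has_vector_derivative fy (x, y)) (at y) \<and>
          (1 / 2) *\<^sub>R (fx (x, y) + I * fy (x, y)) = 0))"

definition power_series_on_ball :: "(quat \<Rightarrow> quat) \<Rightarrow> (nat \<Rightarrow> quat) \<Rightarrow> bool" where
  "power_series_on_ball f a \<longleftrightarrow> (\<forall>q\<in>\<bool>. (\<lambda>n. q ^ n * a n) sums f q)"

definition ps_coeffs :: "(quat \<Rightarrow> quat) \<Rightarrow> nat \<Rightarrow> quat" where
  "ps_coeffs f = (THE a. power_series_on_ball f a)"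

lemma power_series_on_ball_unique:
  assumes "power_series_on_ball f a" "power_series_on_ball f b"
  shows "a = b"
proof -
  define d where "d n = a n - b n" for n
  have s: "(\<lambda>n. inner (d n) u * x ^ n) sums 0" if "\<bar>x\<bar> < 1" for x :: real and u :: quat
  proof -
    have "(of_real x :: quat) \<in> \<bool>" using that by simp
    then have "(\<lambda>n. of_real x ^ n * a n - of_real x ^ n * b n) sums (f (of_real x) - f (of_real x))"
      using assms unfolding power_series_on_ball_def by (intro sums_diff) auto
    then have "(\<lambda>n. x ^ n *\<^sub>R d n) sums 0"
      by (simp add: d_def scaleR_conv_of_real right_diff_distrib)
    from bounded_linear.sums [OF bounded_linear_inner_left [of u] this]
    show ?thesis by (simp add: mult.commute)
  qed
  have "inner (d n) u = 0" for n u
  proof (induction n rule: less_induct)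
    case (less n)
    have "(\<lambda>m. inner (d (m + n)) u * x ^ m) sums 0" if "x \<noteq> 0" "norm x < 1" for x :: real
    proof -
      have "(\<lambda>m. inner (d (m + n)) u * x ^ (m + n)) sums
          (0 - (\<Sum>i<n. inner (d i) u * x ^ i))"
        using s [of x u] that by (intro sums_split_initial_segment) auto
      then have "(\<lambda>m. x ^ n * (inner (d (m + n)) u * x ^ m)) sums 0"
        using less by (simp add: power_add mult_ac)
      from sums_mult_D [OF this] that show ?thesis by simp
    qed
    then have "((\<lambda>x::real. 0::real) \<longlongrightarrow> inner (d (0 + n)) u) (at 0)"
      by (intro powser_limit_0_strong [where s = 1]) auto
    then show ?case by (simp add: tendsto_const_iff)
  qed
  then have "d n = 0" for n
    by (metis inner_eq_zero_iff)
  then show ?thesis by (auto simp: d_def fun_eq_iff)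
qed

lemma ps_coeffs_eq: "power_series_on_ball f a \<Longrightarrow> ps_coeffs f = a"
  unfolding ps_coeffs_def using power_series_on_ball_unique by blast

definition H2 :: "(quat \<Rightarrow> quat) set" where
  "H2 = {f. slice_regular f \<and>
    (\<exists>a. power_series_on_ball f a \<and> summable (\<lambda>n. (norm (a n))\<^sup>2))}"

definition H2_norm :: "(quat \<Rightarrow> quat) \<Rightarrow> real" where
  "H2_norm f = sqrt (\<Sum>n. (norm (ps_coeffs f n))\<^sup>2)"

definition Hinf :: "(quat \<Rightarrow> quat) set" where
  "Hinf = {f. slice_regular f \<and> bounded (f ` \<bool>)}"

text \<open>A supremum of reals, hence meaningful only for members of \<^term>\<open>Hinf\<close>.\<close>

definition Hinf_norm :: "(quat \<Rightarrow> quat) \<Rightarrow> real" where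
  "Hinf_norm f = (SUP q\<in>\<bool>. norm (f q))"

definition star_prod :: "(quat \<Rightarrow> quat) \<Rightarrow> (quat \<Rightarrow> quat) \<Rightarrow> quat \<Rightarrow> quat" (infixl \<open>\<star>\<close> 70) where
  "(f \<star> g) q = (\<Sum>n. q ^ n * (\<Sum>k\<le>n. ps_coeffs f k * ps_coeffs g (n - k)))"

text \<open>The (unnormalized) area measure of the two-sphere of imaginary units, in spherical
  coordinates: the area element is \<open>sin \<theta> d\<theta> d\<phi>\<close> and the total area \<open>4 \<pi>\<close>.\<close>

definition sphere_area :: "quat measure" where
  "sphere_area = distr
    (density lborel (\<lambda>(\<theta>, \<phi>). ennreal (sin \<theta>) * indicator ({0..pi} \<times> {0..<2 * pi}) (\<theta>, \<phi>)))
    borel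
    (\<lambda>(\<theta>, \<phi>). Quat 0 (sin \<theta> * cos \<phi>) (sin \<theta> * sin \<phi>) (cos \<theta>))"

lemma sphere_param_measurable [measurable]:
  "(\<lambda>(\<theta>, \<phi>). Quat 0 (sin \<theta> * cos \<phi>) (sin \<theta> * sin \<phi>) (cos \<theta>)) \<in> borel_measurable borel"
proof -
  have "(\<lambda>x::real \<times> real. sin (fst x) * cos (snd x)) \<in> borel_measurable borel"
    "(\<lambda>x::real \<times> real. sin (fst x) * sin (snd x)) \<in> borel_measurable borel"
    "(\<lambda>x::real \<times> real. cos (fst x)) \<in> borel_measurable borel"
    by (intro borel_measurable_continuous_onI continuous_intros)+
  then show ?thesis
    by (subst borel_measurable_euclidean_space)
      (simp add: Basis_quat_def inner_quat_def case_prod_beta)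
qed

lemma emeasure_sphere_area: "emeasure sphere_area UNIV = ennreal (4 * pi)"
proof -
  have m [measurable]: "(\<lambda>(\<theta>, \<phi>). ennreal (sin \<theta>) * indicator ({0..pi} \<times> {0..<2 * pi}) (\<theta>, \<phi>))
      \<in> borel_measurable (borel \<Otimes>\<^sub>M (borel :: real measure))"
    by measurable
  have "emeasure sphere_area UNIV = (\<integral>\<^sup>+(\<theta>, \<phi>). ennreal (sin \<theta>) *
      indicator ({0..pi} \<times> {0..<2 * pi}) (\<theta>, \<phi>) \<partial>(lborel \<Otimes>\<^sub>M lborel))"
    unfolding sphere_area_def using m sphere_param_measurable
    by (subst emeasure_distr) (auto simp: emeasure_density lborel_prod borel_prod space_pair_measure)
  also have "\<dots> = (\<integral>\<^sup>+\<theta>. \<integral>\<^sup>+\<phi>. (ennreal (sin \<theta>) * indicator {0..pi} \<theta>) * indicator {0..<2 * pi} \<phi>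
      \<partial>lborel \<partial>lborel)"
    using m by (subst lborel.nn_integral_fst [symmetric])
      (auto simp: indicator_times mult.assoc)
  also have "\<dots> = (\<integral>\<^sup>+\<theta>. ennreal (sin \<theta>) * indicator {0..pi} \<theta> \<partial>lborel) * ennreal (2 * pi)"
    by (simp add: nn_integral_cmult nn_integral_multc)
  also have "(\<integral>\<^sup>+\<theta>. ennreal (sin \<theta>) * indicator {0..pi} \<theta> \<partial>lborel) = ennreal (- cos pi - - cos 0)"
    by (rule nn_integral_FTC_Icc) (auto intro!: derivative_eq_intros sin_ge_zero)
  finally show ?thesis by (simp add: ennreal_mult' [symmetric] flip: ennreal_numeral)
qed

text \<open>The measure \<open>d\<Sigma>(e\<^sup>t\<^sup>I) = d\<sigma>(I) dt\<close> is the image of the product measure; it lives on the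
  Borel sets of all quaternions and is concentrated on the unit sphere. The constant
  \<open>8 \<pi>\<^sup>2 = 4 \<pi> \<cdot> 2 \<pi>\<close> normalizes it to a probability measure.\<close>

definition boundary_measure :: "quat measure" where
  "boundary_measure = scale_measure (ennreal (1 / (8 * pi\<^sup>2)))
    (distr (sphere_area \<Otimes>\<^sub>M restrict_space lborel {0..<2 * pi}) borel
      (\<lambda>(I, t). of_real (cos t) + of_real (sin t) * I))"

lemma emeasure_boundary_measure: "emeasure boundary_measure UNIV = 1"
proof -
  let ?N = "restrict_space lborel {0..<2 * pi}"
  have "emeasure ?N (space ?N) = ennreal (2 * pi)"
    by (simp add: emeasure_restrict_space space_restrict_space)
  then interpret N: finite_measure ?N
    by (intro finite_measureI) simp
  have [measurable_cong]: "sets sphere_area = sets borel"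
    by (simp add: sphere_area_def)
  have [measurable]: "(\<lambda>(I, t). of_real (cos t) + of_real (sin t) * I)
      \<in> borel_measurable (sphere_area \<Otimes>\<^sub>M ?N)"
  proof -
    have [measurable]: "(\<lambda>t. t) \<in> borel_measurable ?N"
      by (intro measurable_restrict_space1) simp
    show ?thesis unfolding case_prod_beta by measurable
  qed
  have "emeasure boundary_measure UNIV =
      ennreal (1 / (8 * pi\<^sup>2)) * emeasure (sphere_area \<Otimes>\<^sub>M ?N) (space sphere_area \<times> space ?N)"
    by (simp add: boundary_measure_def emeasure_distr space_pair_measure)
  also have "\<dots> = ennreal (1 / (8 * pi\<^sup>2)) * (ennreal (4 * pi) * ennreal (2 * pi))"
    using \<open>emeasure ?N (space ?N) = _\<close>
    by (subst N.emeasure_pair_measure_Times)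
      (auto simp: sphere_area_def sets_restrict_space space_restrict_space
        emeasure_sphere_area [unfolded sphere_area_def])
  finally show ?thesis
    by (simp add: ennreal_mult [symmetric] power2_eq_square del: ennreal_1 flip: ennreal_1)
qed

definition has_radial_limit :: "(quat \<Rightarrow> quat) \<Rightarrow> quat \<Rightarrow> quat \<Rightarrow> bool" where
  "has_radial_limit f q l \<longleftrightarrow> ((\<lambda>r::real. f (r *\<^sub>R q)) \<longlongrightarrow> l) (at_left 1)"

text \<open>The boundary value of \<open>\<phi>\<close> at \<open>q\<close> is its radial limit; \<open>|\<phi>(q)| = 1\<close> at a boundary point
  means that this limit exists and has norm 1.\<close>

definition inner_function :: "(quat \<Rightarrow> quat) \<Rightarrow> bool" where
  "inner_function \<phi> \<longleftrightarrow> \<phi> \<in> Hinf \<and> (\<forall>q\<in>\<bool>. norm (\<phi> q) \<le> 1) \<and>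
    (AE q in boundary_measure. \<exists>l. has_radial_limit \<phi> q l \<and> norm l = 1)"

end

theory Submission
  imports Defs
begin

text \<open>
  Write \<open>f(q) = \<Sum> q\<^sup>n a\<^sub>n\<close> with \<open>\<Sum> |a\<^sub>n|\<^sup>2 < \<infinity>\<close>. Each of the three conditions is shown to be equivalent to
  \<open>|f| \<le> 1\<close> on the ball together with \<open>\<Sum> |a\<^sub>n|\<^sup>2 = 1\<close>.

  On the circle of radius \<open>r < 1\<close> in the slice of an imaginary unit \<open>I\<close>, the function is the
  Fourier series \<open>\<Sum> e\<^sup>n\<^sup>t\<^sup>I r\<^sup>n a\<^sub>n\<close>, and the characters are orthogonal for the real inner product
  of the quaternions, also with quaternionic coefficients on the right. So the mean of
  \<open>|f|\<^sup>2\<close> over the circle is \<open>\<Sum> r\<^sup>2\<^sup>n |a\<^sub>n|\<^sup>2\<close>, whatever \<open>I\<close> is (\<open>parseval_slice\<close>). This already settles the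
  norm condition, since \<open>|f| \<le> B\<close> implies \<open>\<Sum> |a\<^sub>n|\<^sup>2 \<le> B\<^sup>2\<close>.

  For the multiplier condition, put \<open>g(q) = q\<^sup>k + \<lambda>\<close>. Where \<open>g(q) \<noteq> 0\<close>, one has
  \<open>(g \<star> f)(q) = g(q) f(g(q)\<^sup>-\<^sup>1 q g(q))\<close>, so \<open>|f| \<le> 1\<close> gives \<open>|g \<star> f| \<le> |g|\<close> pointwise and, by Parseval,
  for the norms. Conversely, expanding \<open>\<parallel>(q\<^sup>k + \<lambda>) \<star> f\<parallel>\<^sup>2 \<le> 1 + |\<lambda>|\<^sup>2\<close> for all \<open>\<lambda>\<close> shows that the sequence \<open>a\<close>
  is orthogonal to its shifts, with left quaternionic coefficients allowed
  (\<open>l2_orthogonal_of_contractive\<close>). Hence multiplication by \<open>f\<close> is isometric on polynomials.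
  Applied to a truncation of the reproducing kernel at \<open>w\<close>, this gives \<open>|f(w)| \<le> 1\<close>
  (\<open>norm_le_1_of_orthogonal\<close>).

  For inner functions, the boundary measure is disintegrated over the slices. If radial limits
  of modulus one exist almost everywhere, then they do so in some slice, and dominated
  convergence in Parseval's identity yields \<open>\<Sum> |a\<^sub>n|\<^sup>2 = 1\<close>. Conversely, suppose that \<open>|f| \<le> 1\<close> and
  \<open>\<Sum> |a\<^sub>n|\<^sup>2 = 1\<close>. Radial limits exist almost everywhere in every slice by Fatou's theorem
  (\<open>fatou_radial_limits\<close>), and dominated convergence shows that \<open>1 - |lim f|\<^sup>2 \<ge> 0\<close> has integral zero. The
  set of good boundary points is Borel, so the slices can be put together.

  Fatou's theorem is obtained from a maximal inequality. A Poisson average that exceeds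
  \<open>\<lambda>\<close> forces the average over some symmetric interval to exceed \<open>\<lambda>\<close>
  (\<open>poisson_average_le\<close>), and Vitali's covering lemma bounds the measure of the set of centres of such
  intervals. So \<open>sup\<^sub>r |f(r e\<^sup>t\<^sup>I)|\<close> is small off a small set when \<open>\<Sum> |a\<^sub>n|\<^sup>2\<close> is small, and convergence
  passes from polynomials to square-summable series.
\<close>

section \<open>Slices and Parseval's identity\<close>

lemma imag_unitsD:
  assumes "I \<in> imag_units"
  shows "qRe I = 0" "norm I = 1" "I * I = - 1"
proof -
  show s: "I * I = - 1"
    using assms by (simp add: imag_units_def power2_eq_square)
  then have "norm I * norm I = 1"
    by (metis norm_minus_cancel norm_mult norm_one)
  then have "(norm I)\<^sup>2 = 1\<^sup>2"
    by (simp add: power2_eq_square)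
  then show "norm I = 1"
    by (rule power2_eq_imp_eq) simp_all
  from s have e: "(qRe I)\<^sup>2 - (qI I)\<^sup>2 - (qJ I)\<^sup>2 - (qK I)\<^sup>2 = -1"
    "qRe I * qI I = 0" "qRe I * qJ I = 0" "qRe I * qK I = 0"
    by (auto simp: quat_eq_iff times_quat_def one_quat_def power2_eq_square)
  show "qRe I = 0"
  proof (rule ccontr)
    assume "qRe I \<noteq> 0"
    then have "(qRe I)\<^sup>2 = -1" using e by simp
    then show False by (smt (verit) zero_le_power2)
  qed
qed

lemma imag_unitsI:
  assumes "qRe q = 0" "norm q = 1"
  shows "q \<in> imag_units"
proof -
  have "(norm q)\<^sup>2 = 1" using assms by simp
  then have "(qI q)\<^sup>2 + (qJ q)\<^sup>2 + (qK q)\<^sup>2 = 1"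
    using assms(1) by (simp add: norm_quat_def)
  then show ?thesis
    using assms(1)
    by (simp add: imag_units_def quat_eq_iff power2_eq_square times_quat_def one_quat_def)
qed

lemma quat_of_real_sel [simp]:
  "qRe (of_real x) = x" "qI (of_real x) = 0" "qJ (of_real x) = 0" "qK (of_real x) = 0"
  by (simp_all add: of_real_def one_quat_def)

lemma inner_mult_quat_left: "inner (p * x) (p * y) = (norm p)\<^sup>2 * inner x (y :: quat)"
proof -
  have sq: "(norm p)\<^sup>2 = (qRe p)\<^sup>2 + (qI p)\<^sup>2 + (qJ p)\<^sup>2 + (qK p)\<^sup>2"
    by (simp add: norm_quat_def)
  show ?thesis
    unfolding sq inner_quat_def times_quat_def
    by (simp add: power2_eq_square algebra_simps)
qed

text \<open>The point \<open>e\<^sup>t\<^sup>I = cos t + sin t I\<close> of the unit circle in the slice of \<open>I\<close>; meaningful when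
  \<open>I\<close> is an imaginary unit.\<close>

definition qcis :: "quat \<Rightarrow> real \<Rightarrow> quat" where
  "qcis I t = of_real (cos t) + of_real (sin t) * I"

lemma qcis_0 [simp]: "qcis I 0 = 1"
  by (simp add: qcis_def)

lemma qcis_add:
  assumes "I \<in> imag_units"
  shows "qcis I (s + t) = qcis I s * qcis I t"
proof -
  have "qcis I s * qcis I t = of_real (cos s * cos t) + of_real (sin s * sin t) * (I * I)
      + of_real (sin s * cos t + cos s * sin t) * I"
    by (simp add: quat_eq_iff times_quat_def qcis_def algebra_simps)
  then show ?thesis
    by (simp add: imag_unitsD[OF assms] qcis_def cos_add sin_add)
qed

lemma qcis_power:
  assumes "I \<in> imag_units"
  shows "qcis I t ^ n = qcis I (real n * t)"
  by (induction n) (simp_all add: qcis_add[OF assms] distrib_right)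

lemma norm_qcis:
  assumes "I \<in> imag_units"
  shows "norm (qcis I t) = 1"
proof -
  have "(norm I)\<^sup>2 = 1" using imag_unitsD[OF assms] by simp
  then have *: "(qI I)\<^sup>2 + (qJ I)\<^sup>2 + (qK I)\<^sup>2 = 1"
    using imag_unitsD(1)[OF assms] by (simp add: norm_quat_def)
  have "(norm (qcis I t))\<^sup>2 = (cos t)\<^sup>2 + (sin t)\<^sup>2 * ((qI I)\<^sup>2 + (qJ I)\<^sup>2 + (qK I)\<^sup>2)"
    using imag_unitsD(1)[OF assms]
    by (simp add: norm_quat_def qcis_def scaleR_conv_of_real[symmetric] power_mult_distrib algebra_simps)
  then have "(norm (qcis I t))\<^sup>2 = 1\<^sup>2" using * by simp
  then show ?thesis
    using norm_ge_zero by (metis power2_eq_imp_eq zero_le_one)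
qed

lemma continuous_on_qcis [continuous_intros]:
  fixes g :: "'a::t2_space \<Rightarrow> quat"
  assumes "continuous_on A g" "continuous_on A h"
  shows "continuous_on A (\<lambda>x. qcis (g x) (h x))"
  unfolding qcis_def
  by (intro continuous_on_add continuous_on_mult continuous_on_of_real continuous_on_cos
      continuous_on_sin assms)

text \<open>The real inner product of two monomials depends on the phases only through their difference. No
  commutation between the coefficients and \<open>I\<close> is needed, and this makes the characters
  orthogonal.\<close>

lemma inner_qcis:
  assumes "I \<in> imag_units"
  shows "inner (qcis I s * x) (qcis I t * y)
      = cos (s - t) * inner x y + sin (s - t) * inner (I * x) y"
proof -
  have "qcis I s * x = qcis I t * (qcis I (s - t) * x)"
    using qcis_add[OF assms, of t "s - t"] by (simp add: mult.assoc)
  then have "inner (qcis I s * x) (qcis I t * y) = inner (qcis I (s - t) * x) y"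
    by (simp add: inner_mult_quat_left norm_qcis[OF assms])
  then show ?thesis
    by (simp add: qcis_def scaleR_conv_of_real[symmetric] distrib_right inner_add_left)
qed

text \<open>The one-sided Fourier series on the circle of the slice of \<open>I\<close>, with coefficients on the right.
  It is used only where the series converges.\<close>

definition fourier :: "quat \<Rightarrow> (nat \<Rightarrow> quat) \<Rightarrow> real \<Rightarrow> quat" where
  "fourier I b t = (\<Sum>n. qcis I t ^ n * b n)"

lemma integral_cos_period:
  "((\<lambda>t. cos (real_of_int k * t)) has_integral (if k = 0 then 2 * pi else 0)) {c - pi..c + pi}"
proof (cases "k = 0")
  case True
  then show ?thesis
    using has_integral_const_real[of "1::real" "c - pi" "c + pi"] by simp
next
  case False
  have "((\<lambda>t. cos (k * t)) has_integral (sin (k * (c + pi)) / k - sin (k * (c - pi)) / k)) {c - pi..c + pi}"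
    by (rule fundamental_theorem_of_calculus)
      (use False in \<open>auto intro!: derivative_eq_intros simp: has_real_derivative_iff_has_vector_derivative[symmetric]\<close>)
  moreover have "sin (k * (c + pi)) = sin (k * (c - pi))"
    using sin.plus_of_int[of "k * (c - pi)" k]
    by (simp add: algebra_simps)
  ultimately show ?thesis using False by simp
qed

lemma integral_sin_period:
  "((\<lambda>t. sin (real_of_int k * t)) has_integral 0) {c - pi..c + pi}"
proof (cases "k = 0")
  case True
  then show ?thesis by simp
next
  case False
  have "((\<lambda>t. sin (k * t)) has_integral (- cos (k * (c + pi)) / k - - cos (k * (c - pi)) / k)) {c - pi..c + pi}"
    by (rule fundamental_theorem_of_calculus)
      (use False in \<open>auto intro!: derivative_eq_intros simp: has_real_derivative_iff_has_vector_derivative[symmetric]\<close>)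
  moreover have "cos (k * (c + pi)) = cos (k * (c - pi))"
    using cos.plus_of_int[of "k * (c - pi)" k]
    by (simp add: algebra_simps)
  ultimately show ?thesis using False by simp
qed

lemma parseval_finite:
  assumes I: "I \<in> imag_units"
  shows "((\<lambda>t. (norm (\<Sum>n<N. qcis I t ^ n * b n))\<^sup>2) has_integral
     2 * pi * (\<Sum>n<N. (norm (b n))\<^sup>2)) {c - pi..c + pi}"
proof -
  have e: "(norm (\<Sum>n<N. qcis I t ^ n * b n))\<^sup>2 =
      (\<Sum>m<N. \<Sum>n<N. cos (real_of_int (int m - int n) * t) * inner (b m) (b n)
         + sin (real_of_int (int m - int n) * t) * inner (I * b m) (b n))" for t
    by (simp add: power2_norm_eq_inner inner_sum_left inner_sum_right qcis_power[OF I]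
        inner_qcis[OF I] left_diff_distrib)
       (subst sum.swap, simp add: inner_commute)
  have "((\<lambda>t. (norm (\<Sum>n<N. qcis I t ^ n * b n))\<^sup>2) has_integral
      (\<Sum>m<N. \<Sum>n<N. (if int m - int n = 0 then 2 * pi else 0) * inner (b m) (b n)
         + 0 * inner (I * b m) (b n))) {c - pi..c + pi}"
    unfolding e
    by (intro has_integral_sum has_integral_add has_integral_mult_left
        integral_cos_period integral_sin_period) auto
  also have "(\<Sum>m<N. \<Sum>n<N. (if int m - int n = 0 then 2 * pi else 0) * inner (b m) (b n)
         + 0 * inner (I * b m) (b n)) = (\<Sum>m<N. 2 * pi * inner (b m) (b m))"
    by (intro sum.cong refl) (simp add: if_distribR if_distrib sum.delta cong: if_cong)
  also have "\<dots> = 2 * pi * (\<Sum>n<N. (norm (b n))\<^sup>2)"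
    by (simp add: power2_norm_eq_inner sum_distrib_left)
  finally show ?thesis .
qed

lemma fourier_sums:
  assumes "I \<in> imag_units" "summable (\<lambda>n. norm (b n))"
  shows "(\<lambda>n. qcis I t ^ n * b n) sums fourier I b t"
  unfolding fourier_def
  by (rule summable_sums[OF summable_norm_cancel])
    (use assms in \<open>simp add: norm_mult norm_power norm_qcis\<close>)

lemma fourier_uniform_limit:
  assumes "I \<in> imag_units" "summable (\<lambda>n. norm (b n))"
  shows "uniform_limit UNIV (\<lambda>N t. \<Sum>n<N. qcis I t ^ n * b n) (fourier I b) sequentially"
  unfolding fourier_def[abs_def]
  by (rule Weierstrass_m_test[where M = "\<lambda>n. norm (b n)"])
    (use assms in \<open>simp_all add: norm_mult norm_power norm_qcis\<close>)

lemma continuous_on_fourier: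
  assumes "I \<in> imag_units" "summable (\<lambda>n. norm (b n))"
  shows "continuous_on A (fourier I b)"
proof -
  have "continuous_on UNIV (fourier I b)"
    by (rule uniform_limit_theorem[OF _ fourier_uniform_limit[OF assms]])
      (auto intro!: always_eventually continuous_intros)
  then show ?thesis by (rule continuous_on_subset) simp
qed

lemma norm_fourier_le:
  assumes "I \<in> imag_units" "summable (\<lambda>n. norm (b n))"
  shows "norm (fourier I b t) \<le> (\<Sum>n. norm (b n))"
  unfolding fourier_def
  by (rule order_trans[OF summable_norm])
     (use assms in \<open>simp_all add: norm_mult norm_power norm_qcis\<close>)

lemma summable_norm_square:
  assumes "summable (\<lambda>n. norm (b n))"
  shows "summable (\<lambda>n. (norm (b n))\<^sup>2)"
proof -
  have "\<forall>\<^sub>F n in sequentially. norm (b n) < 1"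
    using order_tendstoD(2)[OF summable_LIMSEQ_zero[OF assms], of 1] by simp
  then have "\<forall>\<^sub>F n in sequentially. norm ((norm (b n))\<^sup>2) \<le> norm (b n)"
    by eventually_elim (simp add: power2_eq_square mult_left_le)
  then show ?thesis
    by (rule summable_comparison_test_ev) (rule assms)
qed

text \<open>The interval is an arbitrary period \<open>[c - \<pi>, c + \<pi>]\<close>, so that no periodicity argument is needed
  later.\<close>

lemma parseval:
  assumes I: "I \<in> imag_units" and b: "summable (\<lambda>n. norm (b n))"
  shows "((\<lambda>t. (norm (fourier I b t))\<^sup>2) has_integral
     2 * pi * (\<Sum>n. (norm (b n))\<^sup>2)) {c - pi..c + pi}"
proof -
  let ?S = "\<lambda>N t. \<Sum>n<N. qcis I t ^ n * b n"
  let ?J = "{c - pi..c + pi}"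
  have bd: "bounded (range (fourier I b))"
    by (rule boundedI[where B = "\<Sum>n. norm (b n)"]) (auto intro: norm_fourier_le I b)
  have "uniform_limit UNIV (\<lambda>N t. inner (?S N t) (?S N t)) (\<lambda>t. inner (fourier I b t) (fourier I b t)) sequentially"
    by (rule bounded_bilinear.bounded_uniform_limit[OF bounded_bilinear_inner])
      (use fourier_uniform_limit[OF I b] bd in \<open>auto simp: \<close>)
  then have u: "uniform_limit ?J (\<lambda>N t. (norm (?S N t))\<^sup>2) (\<lambda>t. (norm (fourier I b t))\<^sup>2) sequentially"
    by (auto simp: power2_norm_eq_inner intro: uniform_limit_on_subset)
  obtain A B where A: "\<And>N. ((\<lambda>t. (norm (?S N t))\<^sup>2) has_integral A N) ?J"
    and B: "((\<lambda>t. (norm (fourier I b t))\<^sup>2) has_integral B) ?J" and AB: "A \<longlonglongrightarrow> B"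
    by (rule uniform_limit_integral[OF u])
      (auto intro!: continuous_intros)
  have eq: "A N = 2 * pi * (\<Sum>n<N. (norm (b n))\<^sup>2)" for N
    using has_integral_unique[OF A parseval_finite[OF I]] .
  have "(\<lambda>N. 2 * pi * (\<Sum>n<N. (norm (b n))\<^sup>2)) \<longlonglongrightarrow> 2 * pi * (\<Sum>n. (norm (b n))\<^sup>2)"
    by (intro tendsto_mult_left summable_LIMSEQ summable_norm_square b)
  then have "A \<longlonglongrightarrow> 2 * pi * (\<Sum>n. (norm (b n))\<^sup>2)"
    using eq by presburger
  then have "B = 2 * pi * (\<Sum>n. (norm (b n))\<^sup>2)"
    using AB by (intro LIMSEQ_unique)
  then show ?thesis using B by simp
qed

section \<open>Square-summable power series and the multiplier condition\<close>

text \<open>Membership of a sequence of quaternions in \<open>\<ell>\<^sup>2\<close>.\<close>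

definition square_summable :: "(nat \<Rightarrow> quat) \<Rightarrow> bool" where
  "square_summable x \<longleftrightarrow> summable (\<lambda>n. (norm (x n))\<^sup>2)"

text \<open>The real inner product of \<open>\<ell>\<^sup>2\<close>; it vanishes for all left multiples of one argument exactly when
  the quaternionic inner product does.\<close>

definition l2_inner :: "(nat \<Rightarrow> quat) \<Rightarrow> (nat \<Rightarrow> quat) \<Rightarrow> real" where
  "l2_inner x y = (\<Sum>n. inner (x n) (y n))"

text \<open>The \<open>k\<close>-fold right shift, that is, multiplication of the power series by \<open>q\<^sup>k\<close>.\<close>

definition shift :: "nat \<Rightarrow> (nat \<Rightarrow> quat) \<Rightarrow> nat \<Rightarrow> quat" where
  "shift k x n = (if n < k then 0 else x (n - k))"

lemma square_summable_add:
  assumes "square_summable x" "square_summable y"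
  shows "square_summable (\<lambda>n. x n + y n)"
proof -
  have "(norm (x n + y n))\<^sup>2 \<le> 2 * (norm (x n))\<^sup>2 + 2 * (norm (y n))\<^sup>2" for n
  proof -
    have "(norm (x n + y n))\<^sup>2 \<le> (norm (x n) + norm (y n))\<^sup>2"
      by (intro power_mono norm_triangle_ineq) simp
    also have "\<dots> \<le> 2 * (norm (x n))\<^sup>2 + 2 * (norm (y n))\<^sup>2"
      using sum_squares_bound[of "norm (x n)" "norm (y n)"] by (simp add: power2_sum)
    finally show ?thesis .
  qed
  moreover have "summable (\<lambda>n. 2 * (norm (x n))\<^sup>2 + 2 * (norm (y n))\<^sup>2)"
    using assms unfolding square_summable_def by (intro summable_add summable_mult)
  ultimately show ?thesis
    unfolding square_summable_def by (simp add: summable_comparison_test')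
qed

lemma square_summable_mult_left:
  "square_summable x \<Longrightarrow> square_summable (\<lambda>n. p * x n)"
  unfolding square_summable_def by (simp add: norm_mult power_mult_distrib summable_mult)

lemma square_summable_sum:
  "finite A \<Longrightarrow> (\<And>i. i \<in> A \<Longrightarrow> square_summable (x i)) \<Longrightarrow> square_summable (\<lambda>n. \<Sum>i\<in>A. x i n)"
proof (induction A rule: finite_induct)
  case empty
  then show ?case by (simp add: square_summable_def)
next
  case (insert i A)
  then show ?case by (simp add: square_summable_add)
qed

text \<open>The function \<open>h\<close> may depend on the index, since the terms to be summed are of the form
  \<open>q\<^sup>n\<close> times the shifted sequence or inner products with another sequence.\<close>

lemma shift_sums_iff:
  assumes "\<And>n. h n 0 = (0 :: 'a :: real_normed_vector)"
  shows "(\<lambda>n. h n (shift k x n)) sums s \<longleftrightarrow> (\<lambda>n. h (n + k) (x n)) sums s"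
proof -
  have "(\<lambda>n. h n (shift k x n)) sums s \<longleftrightarrow>
      (\<lambda>n. h (n + k) (shift k x (n + k))) sums (s - (\<Sum>n<k. h n (shift k x n)))"
    by (rule sums_iff_shift'[symmetric])
  also have "(\<Sum>n<k. h n (shift k x n)) = 0"
    by (simp add: shift_def assms)
  finally show ?thesis by (simp add: shift_def)
qed

lemma square_summable_shift:
  assumes "square_summable x"
  shows "square_summable (shift k x)"
  using assms shift_sums_iff[of "\<lambda>_ z. (norm z)\<^sup>2" k x]
  by (auto simp: square_summable_def summable_def)

lemma summable_l2_inner:
  assumes "square_summable x" "square_summable y"
  shows "summable (\<lambda>n. inner (x n) (y n))"
proof (rule summable_comparison_test')
  show "summable (\<lambda>n. (norm (x n))\<^sup>2 + (norm (y n))\<^sup>2)"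
    using assms by (simp add: square_summable_def summable_add)
  show "norm (inner (x n) (y n)) \<le> (norm (x n))\<^sup>2 + (norm (y n))\<^sup>2" if "n \<ge> 0" for n
  proof -
    have "norm (inner (x n) (y n)) \<le> norm (x n) * norm (y n)"
      by (simp add: Cauchy_Schwarz_ineq2)
    also have "\<dots> \<le> (norm (x n))\<^sup>2 + (norm (y n))\<^sup>2"
      using sum_squares_bound[of "norm (x n)" "norm (y n)"]
        mult_nonneg_nonneg[OF norm_ge_zero[of "x n"] norm_ge_zero[of "y n"]] by linarith
    finally show ?thesis .
  qed
qed

lemma l2_inner_self: "l2_inner x x = (\<Sum>n. (norm (x n))\<^sup>2)"
  by (simp add: l2_inner_def power2_norm_eq_inner)

lemma l2_inner_commute: "l2_inner x y = l2_inner y x"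
  by (simp add: l2_inner_def inner_commute)

lemma l2_inner_shift: "l2_inner (shift k x) (shift k y) = l2_inner x y"
proof -
  have "inner (shift k x n) (shift k y n) = inner (shift k x n) (y (n - k))" for n
    by (simp add: shift_def)
  then show ?thesis
    using shift_sums_iff[of "\<lambda>n z. inner z (y (n - k))" k x]
    by (simp add: l2_inner_def suminf_def)
qed

lemma l2_inner_sum_self:
  assumes "finite A" "\<And>i. i \<in> A \<Longrightarrow> square_summable (x i)"
  shows "l2_inner (\<lambda>n. \<Sum>i\<in>A. x i n) (\<lambda>n. \<Sum>i\<in>A. x i n) = (\<Sum>i\<in>A. \<Sum>j\<in>A. l2_inner (x i) (x j))"
proof -
  have "(\<lambda>n. \<Sum>i\<in>A. \<Sum>j\<in>A. inner (x i n) (x j n)) sums (\<Sum>i\<in>A. \<Sum>j\<in>A. l2_inner (x i) (x j))"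
    unfolding l2_inner_def by (intro sums_sum summable_sums summable_l2_inner assms)
  moreover have "(\<Sum>i\<in>A. \<Sum>j\<in>A. inner (x i n) (x j n)) = inner (\<Sum>i\<in>A. x i n) (\<Sum>i\<in>A. x i n)" for n
    unfolding inner_sum_left inner_sum_right by (rule sum.swap)
  ultimately show ?thesis
    unfolding l2_inner_def by (simp add: sums_iff)
qed

lemma square_summable_power_series:
  assumes a: "square_summable a" and q: "norm q < 1"
  shows "summable (\<lambda>n. norm (q ^ n * a n))"
proof -
  have "(\<lambda>n. (norm (a n))\<^sup>2) \<longlonglongrightarrow> 0"
    using a unfolding square_summable_def by (rule summable_LIMSEQ_zero)
  then have "\<forall>\<^sub>F n in sequentially. (norm (a n))\<^sup>2 < 1"
    by (rule order_tendstoD) simp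
  then have "\<forall>\<^sub>F n in sequentially. norm (norm (q ^ n * a n)) \<le> norm q ^ n"
  proof eventually_elim
    case (elim n)
    then have "norm (a n) \<le> 1"
      by (simp add: power_less_one_iff abs_square_less_1 less_imp_le)
    then show ?case
      by (simp add: norm_mult norm_power mult_left_le)
  qed
  then show ?thesis
    by (rule summable_comparison_test_ev) (use q in \<open>simp add: summable_geometric\<close>)
qed

lemma power_series_on_ball_suminf:
  assumes "square_summable a"
  shows "power_series_on_ball (\<lambda>q. \<Sum>n. q ^ n * a n) a"
  unfolding power_series_on_ball_def
  using square_summable_power_series[OF assms] summable_norm_cancel summable_sums by fastforce

lemma slice_point_in_ball:
  assumes "I \<in> imag_units" "0 \<le> r" "r < 1"
  shows "r *\<^sub>R qcis I t \<in> \<bool>"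
  using assms by (simp add: norm_qcis)

lemma slice_eq_fourier:
  assumes "power_series_on_ball f a" "I \<in> imag_units" "0 \<le> r" "r < 1"
  shows "f (r *\<^sub>R qcis I t) = fourier I (\<lambda>n. r ^ n *\<^sub>R a n) t"
proof -
  have "(\<lambda>n. (r *\<^sub>R qcis I t) ^ n * a n) sums f (r *\<^sub>R qcis I t)"
    using assms(1) slice_point_in_ball[OF assms(2-4)] unfolding power_series_on_ball_def by blast
  then show ?thesis
    by (simp add: fourier_def sums_iff scaleR_power)
qed

lemma summable_dilate:
  assumes "square_summable a" "0 \<le> r" "r < 1"
  shows "summable (\<lambda>n. norm (r ^ n *\<^sub>R a n))"
  using square_summable_power_series[OF assms(1), of "of_real r"] assms(2,3)
  by (simp add: norm_mult norm_power)

lemma parseval_slice: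
  assumes "power_series_on_ball f a" "square_summable a" "I \<in> imag_units" "0 \<le> r" "r < 1"
  shows "((\<lambda>t. (norm (f (r *\<^sub>R qcis I t)))\<^sup>2) has_integral
    2 * pi * (\<Sum>n. (norm (r ^ n *\<^sub>R a n))\<^sup>2)) {c - pi..c + pi}"
  using parseval[OF assms(3) summable_dilate[OF assms(2,4,5)], of c] slice_eq_fourier[OF assms(1,3-5)]
  by simp

lemma norm_dilate_le:
  assumes "0 \<le> r" "r < 1"
  shows "(norm (r ^ n *\<^sub>R (a n :: quat)))\<^sup>2 \<le> (norm (a n))\<^sup>2"
  using assms by (intro power_mono) (auto simp: mult_left_le_one_le power_le_one)

lemma sum_square_le_of_dilates:
  assumes a: "square_summable a"
    and le: "\<And>r. 0 \<le> r \<Longrightarrow> r < 1 \<Longrightarrow> (\<Sum>n. (norm (r ^ n *\<^sub>R a n))\<^sup>2) \<le> B"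
  shows "(\<Sum>n. (norm (a n))\<^sup>2) \<le> B"
proof (rule suminf_le_const)
  show "summable (\<lambda>n. (norm (a n))\<^sup>2)" using a by (simp add: square_summable_def)
  fix N
  have "((\<lambda>r. \<Sum>n<N. (norm (r ^ n *\<^sub>R a n))\<^sup>2) \<longlongrightarrow> (\<Sum>n<N. (norm (1 ^ n *\<^sub>R a n))\<^sup>2)) (at_left (1::real))"
    by (intro tendsto_intros)
  moreover have "\<forall>\<^sub>F r in at_left (1::real). (\<Sum>n<N. (norm (r ^ n *\<^sub>R a n))\<^sup>2) \<le> B"
  proof (rule eventually_mono)
    show "\<forall>\<^sub>F r in at_left (1::real). r \<in> {0<..<1}"
      by (rule eventually_at_left_real) simp
    fix r :: real assume r: "r \<in> {0<..<1}"
    have "(\<Sum>n<N. (norm (r ^ n *\<^sub>R a n))\<^sup>2) \<le> (\<Sum>n. (norm (r ^ n *\<^sub>R a n))\<^sup>2)"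
      using r by (intro sum_le_suminf summable_norm_square summable_dilate a) auto
    also have "\<dots> \<le> B" using r by (intro le) auto
    finally show "(\<Sum>n<N. (norm (r ^ n *\<^sub>R a n))\<^sup>2) \<le> B" .
  qed
  ultimately show "(\<Sum>n<N. (norm (a n))\<^sup>2) \<le> B"
    by (intro tendsto_upperbound[where F = "at_left (1::real)"]) auto
qed

text \<open>Parseval on circles of radius \<open>r < 1\<close> and the limit \<open>r \<rightarrow> 1\<close>; a single slice is enough.\<close>

lemma sum_square_le_of_norm_le:
  assumes f: "power_series_on_ball f a" "square_summable a"
    and g: "power_series_on_ball g b" "square_summable b"
    and le: "\<And>q. q \<in> \<bool> \<Longrightarrow> norm (f q) \<le> norm (g q)"
  shows "(\<Sum>n. (norm (a n))\<^sup>2) \<le> (\<Sum>n. (norm (b n))\<^sup>2)"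
proof (rule sum_square_le_of_dilates[OF f(2)])
  fix r :: real assume r: "0 \<le> r" "r < 1"
  have I: "Quat 0 1 0 0 \<in> imag_units"
    by (intro imag_unitsI) (simp_all add: norm_quat_def)
  have "2 * pi * (\<Sum>n. (norm (r ^ n *\<^sub>R a n))\<^sup>2) \<le> 2 * pi * (\<Sum>n. (norm (r ^ n *\<^sub>R b n))\<^sup>2)"
    by (rule has_integral_le[OF parseval_slice[OF f I r, of 0] parseval_slice[OF g I r, of 0]])
      (intro power_mono le slice_point_in_ball[OF I r] norm_ge_zero)
  also have "(\<Sum>n. (norm (r ^ n *\<^sub>R b n))\<^sup>2) \<le> (\<Sum>n. (norm (b n))\<^sup>2)"
    using g(2) r
    by (intro suminf_le norm_dilate_le summable_norm_square[OF summable_dilate])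
       (auto simp: square_summable_def)
  finally show "(\<Sum>n. (norm (r ^ n *\<^sub>R a n))\<^sup>2) \<le> (\<Sum>n. (norm (b n))\<^sup>2)" by simp
qed

lemma power_series_const: "power_series_on_ball (\<lambda>_. l) (\<lambda>n. if n = 0 then l else 0)"
  unfolding power_series_on_ball_def
proof
  fix q :: quat
  show "(\<lambda>n. q ^ n * (if n = 0 then l else 0)) sums l"
    using sums_single[of 0 "\<lambda>n. q ^ n * l"] by (simp add: if_distrib cong: if_cong)
qed

lemma sum_square_le_of_bounded:
  assumes f: "power_series_on_ball f a" "square_summable a"
    and le: "\<And>q. q \<in> \<bool> \<Longrightarrow> norm (f q) \<le> B"
  shows "(\<Sum>n. (norm (a n))\<^sup>2) \<le> B\<^sup>2"
proof -
  have B: "0 \<le> B" using le[of 0] by (meson centre_in_ball norm_ge_zero order_trans zero_less_one)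
  let ?b = "\<lambda>n. if n = 0 then of_real B else (0::quat)"
  have *: "(\<lambda>n. (norm (?b n))\<^sup>2) sums B\<^sup>2"
    using sums_single[of 0 "\<lambda>n. B\<^sup>2"] by (simp add: if_distrib[of "\<lambda>x. (norm x)\<^sup>2"] cong: if_cong)
  have "(\<Sum>n. (norm (a n))\<^sup>2) \<le> (\<Sum>n. (norm (?b n))\<^sup>2)"
    by (rule sum_square_le_of_norm_le[OF f power_series_const])
      (use le * B in \<open>auto simp: square_summable_def sums_iff\<close>)
  then show ?thesis using * by (simp add: sums_iff)
qed

text \<open>The power series coefficients of \<open>q\<^sup>k + l\<close>. The two terms add up in degree zero when \<open>k = 0\<close>.\<close>

definition binomial_coeffs :: "nat \<Rightarrow> quat \<Rightarrow> nat \<Rightarrow> quat" where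
  "binomial_coeffs k l n = (if n = k then 1 else 0) + (if n = 0 then l else 0)"

lemma power_series_binom: "power_series_on_ball (\<lambda>q. q ^ k + l) (binomial_coeffs k l)"
  unfolding power_series_on_ball_def
proof
  fix q :: quat
  have "(\<lambda>n. (if n = k then q ^ n else 0) + (if n = 0 then l else 0)) sums (q ^ k + l)"
    using sums_add[OF sums_single[of k "\<lambda>n. q ^ n"] sums_single[of 0 "\<lambda>n. l"]] .
  moreover have "q ^ n * binomial_coeffs k l n = (if n = k then q ^ n else 0) + (if n = 0 then l else 0)" for n
    by (simp add: binomial_coeffs_def)
  ultimately show "(\<lambda>n. q ^ n * binomial_coeffs k l n) sums (q ^ k + l)" by simp
qed

lemma square_summable_binom: "square_summable (binomial_coeffs k l)"
  unfolding square_summable_def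
  by (rule summable_finite[where N = "{0, k}"]) (auto simp: binomial_coeffs_def)

lemma sum_square_binom:
  assumes "k > 0"
  shows "(\<Sum>n. (norm (binomial_coeffs k l n))\<^sup>2) = 1 + (norm l)\<^sup>2"
proof -
  have "(\<Sum>n. (norm (binomial_coeffs k l n))\<^sup>2) = (\<Sum>n\<in>{0, k}. (norm (binomial_coeffs k l n))\<^sup>2)"
    by (rule suminf_finite) (auto simp: binomial_coeffs_def)
  then show ?thesis using assms by (simp add: binomial_coeffs_def)
qed

lemma binom_convolution:
  "(\<Sum>j\<le>n. binomial_coeffs k l j * a (n - j)) = shift k a n + l * a n"
proof -
  have "(\<Sum>j\<le>n. binomial_coeffs k l j * a (n - j))
      = (\<Sum>j\<le>n. if j = k then a (n - j) else 0) + (\<Sum>j\<le>n. if j = 0 then l * a (n - j) else 0)"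
    unfolding sum.distrib[symmetric]
    by (intro sum.cong refl) (auto simp: binomial_coeffs_def distrib_right)
  then show ?thesis by (simp add: sum.delta shift_def)
qed

lemma power_series_star_binom:
  assumes "power_series_on_ball f a" "square_summable a"
  shows "power_series_on_ball ((\<lambda>q. q ^ k + l) \<star> f) (\<lambda>n. shift k a n + l * a n)"
    and "square_summable (\<lambda>n. shift k a n + l * a n)"
proof -
  show s: "square_summable (\<lambda>n. shift k a n + l * a n)"
    by (intro square_summable_add square_summable_shift square_summable_mult_left assms)
  have "(\<lambda>q. q ^ k + l) \<star> f = (\<lambda>q. \<Sum>n. q ^ n * (shift k a n + l * a n))"
    by (rule ext) (simp add: star_prod_def ps_coeffs_eq[OF power_series_binom]
        ps_coeffs_eq[OF assms(1)] binom_convolution)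
  then show "power_series_on_ball ((\<lambda>q. q ^ k + l) \<star> f) (\<lambda>n. shift k a n + l * a n)"
    using power_series_on_ball_suminf[OF s] by simp
qed

text \<open>Powers of \<open>q\<close> commute with \<open>q\<^sup>k\<close> but not with \<open>l\<close>, so the factor \<open>q\<^sup>k + l\<close> stays in the middle.\<close>

lemma star_binom_value:
  assumes f: "power_series_on_ball f a" "square_summable a" and q: "q \<in> \<bool>"
  shows "(\<lambda>n. q ^ n * (q ^ k + l) * a n) sums (((\<lambda>q. q ^ k + l) \<star> f) q)"
proof -
  have "(\<lambda>n. q ^ n * (shift k a n + l * a n)) sums (((\<lambda>q. q ^ k + l) \<star> f) q)"
    using power_series_star_binom(1)[OF f] q by (auto simp: power_series_on_ball_def)
  moreover have la: "summable (\<lambda>n. q ^ n * (l * a n))"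
    using square_summable_power_series[OF square_summable_mult_left[OF f(2)]] q
    by (auto intro: summable_norm_cancel)
  ultimately have "(\<lambda>n. q ^ n * shift k a n) sums (((\<lambda>q. q ^ k + l) \<star> f) q - (\<Sum>n. q ^ n * (l * a n)))"
    using sums_diff[OF _ summable_sums[OF la]] by (fastforce simp: distrib_left)
  then have "(\<lambda>n. q ^ (n + k) * a n) sums (((\<lambda>q. q ^ k + l) \<star> f) q - (\<Sum>n. q ^ n * (l * a n)))"
    by (subst (asm) shift_sums_iff) auto
  from sums_add[OF this summable_sums[OF la]] show ?thesis
    by (simp add: algebra_simps power_add)
qed

lemma power_conj:
  fixes g q :: quat
  assumes "g \<noteq> 0"
  shows "q ^ n * g = g * (inverse g * q * g) ^ n"
proof (induction n)
  case (Suc n)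
  have "q ^ Suc n * g = q ^ n * g * (inverse g * q * g)"
    using assms by (simp add: power_Suc2 mult.assoc del: power_Suc) (simp flip: mult.assoc)
  then show ?case using Suc by (simp add: power_commutes mult.assoc)
qed simp

text \<open>With \<open>g = q\<^sup>k + l \<noteq> 0\<close>, the value of the product at \<open>q\<close> is \<open>g\<close> times the value of \<open>f\<close> at the conjugate
  \<open>g\<^sup>-\<^sup>1 q g\<close>, a point of the same modulus as \<open>q\<close>.\<close>

lemma norm_star_binom_le:
  assumes f: "power_series_on_ball f a" "square_summable a"
    and le: "\<And>q. q \<in> \<bool> \<Longrightarrow> norm (f q) \<le> 1" and q: "q \<in> \<bool>"
  shows "norm (((\<lambda>q. q ^ k + l) \<star> f) q) \<le> norm (q ^ k + l)"
proof (cases "q ^ k + l = 0")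
  case True
  then have "(\<lambda>_::nat. 0) sums (((\<lambda>q. q ^ k + l) \<star> f) q)"
    using star_binom_value[OF f q, of k l] by simp
  then show ?thesis using True sums_unique2[OF sums_zero] by force
next
  case False
  let ?g = "q ^ k + l"
  let ?q = "inverse ?g * q * ?g"
  have "norm ?q = norm q"
    using False by (simp add: norm_mult norm_inverse mult.commute[of "norm q"] flip: mult.assoc)
  then have q': "?q \<in> \<bool>" using q by simp
  have "(\<lambda>n. ?g * (?q ^ n * a n)) sums (?g * f ?q)"
    using f(1) q' unfolding power_series_on_ball_def by (intro sums_mult) auto
  moreover have "?g * (?q ^ n * a n) = q ^ n * ?g * a n" for n
    using power_conj[OF False, of q n] by (simp add: mult.assoc)
  ultimately have "((\<lambda>q. q ^ k + l) \<star> f) q = ?g * f ?q"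
    using star_binom_value[OF f q, of k l] sums_unique2 by simp
  then show ?thesis using le[OF q'] by (simp add: norm_mult mult_left_le)
qed

lemma star_binom_contractive:
  assumes f: "power_series_on_ball f a" "square_summable a"
    and le: "\<And>q. q \<in> \<bool> \<Longrightarrow> norm (f q) \<le> 1"
  shows "H2_norm ((\<lambda>q. q ^ k + l) \<star> f) \<le> H2_norm (\<lambda>q. q ^ k + l)"
  unfolding H2_norm_def ps_coeffs_eq[OF power_series_binom] ps_coeffs_eq[OF power_series_star_binom(1)[OF f]]
  by (intro real_sqrt_le_mono sum_square_le_of_norm_le[OF power_series_star_binom[OF f]
      power_series_binom square_summable_binom norm_star_binom_le[OF f le]])

text \<open>The inequality says that \<open>2 Re \<langle>S\<^sup>k a, l a\<rangle> \<le> 0\<close>. Since \<open>l\<close> may be replaced by \<open>- l\<close>, the inner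
  product vanishes.\<close>

lemma l2_orthogonal_of_contractive:
  assumes f: "power_series_on_ball f a" "square_summable a"
    and one: "(\<Sum>n. (norm (a n))\<^sup>2) = 1"
    and le: "\<And>l. H2_norm ((\<lambda>q. q ^ k + l) \<star> f) \<le> H2_norm (\<lambda>q. q ^ k + l)"
    and k: "k > 0"
  shows "l2_inner (shift k a) (\<lambda>n. l * a n) = 0"
proof -
  have neg: "l2_inner (shift k a) (\<lambda>n. l * a n) \<le> 0" for l
  proof -
    let ?x = "shift k a" and ?y = "\<lambda>n. l * a n"
    have xs: "square_summable ?x" "square_summable ?y"
      by (intro square_summable_shift square_summable_mult_left f)+
    have "(\<Sum>n. (norm (?x n + ?y n))\<^sup>2) \<le> 1 + (norm l)\<^sup>2"
      using le[of l] sum_square_binom[OF k, of l]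
      unfolding H2_norm_def ps_coeffs_eq[OF power_series_binom] ps_coeffs_eq[OF power_series_star_binom(1)[OF f]]
      by simp
    moreover have "(\<lambda>n. (norm (?x n))\<^sup>2 + (norm (?y n))\<^sup>2 + 2 * inner (?x n) (?y n)) sums
        ((\<Sum>n. (norm (?x n))\<^sup>2) + (\<Sum>n. (norm (?y n))\<^sup>2) + 2 * l2_inner ?x ?y)"
      unfolding l2_inner_def using xs
      by (intro sums_add sums_mult summable_sums summable_l2_inner) (auto simp: square_summable_def)
    moreover have "(norm (?x n))\<^sup>2 + (norm (?y n))\<^sup>2 + 2 * inner (?x n) (?y n) = (norm (?x n + ?y n))\<^sup>2" for n
      by (simp add: power2_norm_eq_inner inner_add_left inner_add_right inner_commute)
    moreover have "(\<Sum>n. (norm (?x n))\<^sup>2) = 1"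
      using l2_inner_shift[of k a a] one by (simp add: l2_inner_self)
    moreover have "(\<Sum>n. (norm (?y n))\<^sup>2) = (norm l)\<^sup>2"
      using one f(2) by (simp add: norm_mult power_mult_distrib suminf_mult square_summable_def)
    ultimately show ?thesis by (simp add: sums_iff)
  qed
  have "l2_inner (shift k a) (\<lambda>n. - l * a n) = - l2_inner (shift k a) (\<lambda>n. l * a n)"
    unfolding l2_inner_def
    by (subst suminf_minus[symmetric])
      (auto intro!: summable_l2_inner square_summable_shift square_summable_mult_left f)
  with neg[of l] neg[of "- l"] show ?thesis by simp
qed

text \<open>Different shifts of \<open>a\<close> stay orthogonal after left multiplication by arbitrary quaternions: a
  common shift cancels, and the remaining left factor is moved to the other side.\<close>

lemma l2_inner_mult_shift:
  assumes a: "square_summable a"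
    and orth: "\<And>k l. k > 0 \<Longrightarrow> l2_inner (shift k a) (\<lambda>n. l * a n) = 0"
    and "i \<noteq> j"
  shows "l2_inner (\<lambda>n. p * shift i a n) (\<lambda>n. p' * shift j a n) = 0"
proof -
  have *: "l2_inner (\<lambda>n. p * shift i a n) (\<lambda>n. p' * shift j a n) = 0" if "j < i" for i j p p'
  proof (cases "p = 0")
    case True
    then show ?thesis by (simp add: l2_inner_def)
  next
    case False
    have s: "shift i a = shift j (shift (i - j) a)"
      using that by (auto simp: shift_def fun_eq_iff)
    have m: "(\<lambda>n. c * shift j x n) = shift j (\<lambda>n. c * x n)" for c x
      by (auto simp: shift_def)
    have "l2_inner (\<lambda>n. p * shift i a n) (\<lambda>n. p' * shift j a n)
        = l2_inner (\<lambda>n. p * shift (i - j) a n) (\<lambda>n. p' * a n)"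
      unfolding s m l2_inner_shift ..
    also have "\<dots> = (\<Sum>n. (norm p)\<^sup>2 * inner (shift (i - j) a n) (inverse p * p' * a n))"
      unfolding l2_inner_def
    proof (intro suminf_cong)
      fix n
      have "p' * a n = p * (inverse p * p' * a n)"
        using False by (simp flip: mult.assoc)
      then show "inner (p * shift (i - j) a n) (p' * a n)
          = (norm p)\<^sup>2 * inner (shift (i - j) a n) (inverse p * p' * a n)"
        by (metis inner_mult_quat_left)
    qed
    also have "\<dots> = (norm p)\<^sup>2 * l2_inner (shift (i - j) a) (\<lambda>n. inverse p * p' * a n)"
      unfolding l2_inner_def
      by (intro suminf_mult summable_l2_inner square_summable_shift square_summable_mult_left a)
    also have "\<dots> = 0" using orth that by simp
    finally show ?thesis .
  qed
  from \<open>i \<noteq> j\<close> consider "j < i" | "i < j" by linarith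
  then show ?thesis
    by cases (metis * l2_inner_commute)+
qed

lemma power_series_Cauchy_Schwarz:
  assumes b: "square_summable b" and w: "norm w < 1" and s: "(\<lambda>n. w ^ n * b n) sums z"
  shows "(norm z)\<^sup>2 \<le> (\<Sum>n. (norm (b n))\<^sup>2) / (1 - (norm w)\<^sup>2)"
proof -
  have w2: "(norm w)\<^sup>2 < 1" using w by (simp add: power_less_one_iff)
  have "(\<lambda>N. (norm (\<Sum>n<N. w ^ n * b n))\<^sup>2) \<longlonglongrightarrow> (norm z)\<^sup>2"
    using s unfolding sums_def by (intro tendsto_intros)
  then show ?thesis
  proof (rule LIMSEQ_le_const2, intro exI allI impI)
    fix N :: nat
    have "norm (\<Sum>n<N. w ^ n * b n) \<le> (\<Sum>n<N. norm w ^ n * norm (b n))"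
      by (rule order_trans[OF norm_sum]) (simp add: norm_mult norm_power)
    then have "(norm (\<Sum>n<N. w ^ n * b n))\<^sup>2 \<le> (\<Sum>n<N. norm w ^ n * norm (b n))\<^sup>2"
      by (intro power_mono) auto
    also have "\<dots> \<le> (\<Sum>n<N. (norm w ^ n)\<^sup>2) * (\<Sum>n<N. (norm (b n))\<^sup>2)"
      by (rule Cauchy_Schwarz_ineq_sum)
    also have "\<dots> \<le> (1 / (1 - (norm w)\<^sup>2)) * (\<Sum>n. (norm (b n))\<^sup>2)"
    proof (intro mult_mono sum_nonneg)
      have "(\<Sum>n<N. (norm w ^ n)\<^sup>2) = (\<Sum>n<N. ((norm w)\<^sup>2) ^ n)"
        by (simp add: power_mult[symmetric] mult.commute)
      also have "\<dots> \<le> (\<Sum>n. ((norm w)\<^sup>2) ^ n)"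
        using w2 by (intro sum_le_suminf) (auto simp: summable_geometric)
      also have "\<dots> = 1 / (1 - (norm w)\<^sup>2)"
        using w2 by (intro suminf_geometric) auto
      finally show "(\<Sum>n<N. (norm w ^ n)\<^sup>2) \<le> 1 / (1 - (norm w)\<^sup>2)" .
      show "(\<Sum>n<N. (norm (b n))\<^sup>2) \<le> (\<Sum>n. (norm (b n))\<^sup>2)"
        using b by (intro sum_le_suminf) (auto simp: square_summable_def)
    qed (use w2 in auto)
    finally show "(norm (\<Sum>n<N. w ^ n * b n))\<^sup>2 \<le> (\<Sum>n. (norm (b n))\<^sup>2) / (1 - (norm w)\<^sup>2)"
      by simp
  qed
qed

text \<open>The polynomial \<open>\<Sum> q\<^sup>k v\<^sup>k\<close>, summed over \<open>k < N\<close>, with \<open>v\<close> the conjugate of \<open>w\<close> is a truncated reproducing kernel. Its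
  \<open>\<star>\<close>-product with \<open>f\<close> has the coefficients \<open>b\<close> below; orthogonality gives \<open>\<Sum> |b\<^sub>n|\<^sup>2 = s\<^sub>N\<close> with
  \<open>s\<^sub>N = \<Sum> |w|\<^sup>2\<^sup>k\<close> over the same range, and its value at \<open>w\<close> is \<open>s\<^sub>N f(w)\<close>. The Cauchy--Schwarz inequality then bounds
  \<open>s\<^sub>N |f(w)|\<^sup>2\<close> by \<open>1 / (1 - |w|\<^sup>2)\<close>, which is the limit of \<open>s\<^sub>N\<close>.\<close>

lemma norm_le_1_of_orthogonal:
  assumes f: "power_series_on_ball f a" "square_summable a"
    and one: "(\<Sum>n. (norm (a n))\<^sup>2) = 1"
    and orth: "\<And>k l. k > 0 \<Longrightarrow> l2_inner (shift k a) (\<lambda>n. l * a n) = 0"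
    and w: "w \<in> \<bool>"
  shows "norm (f w) \<le> 1"
proof -
  \<comment> \<open>The conjugate of \<open>w\<close>; the default value of \<open>inverse\<close> makes this correct at \<open>w = 0\<close> too.\<close>
  define v where "v = (norm w)\<^sup>2 *\<^sub>R inverse w"
  have wv: "w * v = of_real ((norm w)\<^sup>2)" "v * w = of_real ((norm w)\<^sup>2)"
    by (cases "w = 0"; simp add: v_def of_real_def)+
  have wvk: "w ^ k * v ^ k = of_real ((norm w)\<^sup>2 ^ k)" for k
  proof (induction k)
    case (Suc k)
    have "w ^ Suc k * v ^ Suc k = w * (w ^ k * v ^ k) * v"
      by (simp add: power_Suc2[of v] mult.assoc del: power_Suc) (simp add: mult.assoc)
    also have "\<dots> = ((norm w)\<^sup>2 ^ k) *\<^sub>R (w * v)"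
      unfolding Suc.IH by (simp add: of_real_def)
    finally show ?case by (simp add: wv of_real_def mult.commute)
  qed simp
  have nv: "norm v = norm w"
    by (cases "w = 0") (simp_all add: v_def norm_inverse power2_eq_square)
  have w1: "norm w < 1" and w2: "(norm w)\<^sup>2 < 1" using w by (simp_all add: power_less_one_iff)
  define s where "s N = (\<Sum>k<N. ((norm w)\<^sup>2) ^ k)" for N
  have bound: "s N * (norm (f w))\<^sup>2 \<le> 1 / (1 - (norm w)\<^sup>2)" if "N > 0" for N
  proof -
    define b where "b n = (\<Sum>k<N. v ^ k * shift k a n)" for n
    have ss: "square_summable (\<lambda>n. v ^ k * shift k a n)" for k
      by (intro square_summable_mult_left square_summable_shift f)
    have bs: "square_summable b"
      unfolding b_def[abs_def] by (intro square_summable_sum ss) auto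
    have "(\<Sum>n. (norm (b n))\<^sup>2) = (\<Sum>i<N. \<Sum>j<N. l2_inner (\<lambda>n. v ^ i * shift i a n) (\<lambda>n. v ^ j * shift j a n))"
      unfolding l2_inner_self[symmetric] b_def[abs_def] by (rule l2_inner_sum_self) (auto intro: ss)
    also have "\<dots> = (\<Sum>i<N. \<Sum>j<N. if i = j then ((norm w)\<^sup>2) ^ i else 0)"
    proof (intro sum.cong refl)
      fix i j
      show "l2_inner (\<lambda>n. v ^ i * shift i a n) (\<lambda>n. v ^ j * shift j a n) = (if i = j then ((norm w)\<^sup>2) ^ i else 0)"
      proof (cases "i = j")
        case True
        have "l2_inner (\<lambda>n. v ^ i * shift i a n) (\<lambda>n. v ^ i * shift i a n)
            = (\<Sum>n. ((norm w)\<^sup>2) ^ i * (norm (shift i a n))\<^sup>2)"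
          by (simp add: l2_inner_self norm_mult norm_power nv power_mult_distrib power_mult[symmetric] mult.commute)
        also have "\<dots> = ((norm w)\<^sup>2) ^ i * (\<Sum>n. (norm (shift i a n))\<^sup>2)"
          using square_summable_shift[OF f(2)] by (intro suminf_mult) (simp add: square_summable_def)
        also have "(\<Sum>n. (norm (shift i a n))\<^sup>2) = 1"
          using l2_inner_shift[of i a a] one by (simp add: l2_inner_self)
        finally show ?thesis using True by simp
      next
        case False
        then show ?thesis using l2_inner_mult_shift[OF f(2) orth] by simp
      qed
    qed
    also have "\<dots> = s N" by (simp add: s_def sum.delta)
    finally have nb: "(\<Sum>n. (norm (b n))\<^sup>2) = s N" .
    have "(\<lambda>n. w ^ n * (v ^ k * shift k a n)) sums (((norm w)\<^sup>2) ^ k *\<^sub>R f w)" for k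
    proof (subst shift_sums_iff)
      have "(\<lambda>n. ((norm w)\<^sup>2) ^ k *\<^sub>R (w ^ n * a n)) sums (((norm w)\<^sup>2) ^ k *\<^sub>R f w)"
        using f(1) w by (intro sums_scaleR_right) (auto simp: power_series_on_ball_def)
      moreover have "w ^ (n + k) * (v ^ k * a n) = ((norm w)\<^sup>2) ^ k *\<^sub>R (w ^ n * a n)" for n
      proof -
        have "w ^ (n + k) * (v ^ k * a n) = w ^ n * (w ^ k * v ^ k) * a n"
          by (simp add: power_add mult.assoc)
        then show ?thesis by (simp add: wvk) (simp add: of_real_def)
      qed
      ultimately show "(\<lambda>n. w ^ (n + k) * (v ^ k * a n)) sums (((norm w)\<^sup>2) ^ k *\<^sub>R f w)"
        by simp
    qed simp
    then have "(\<lambda>n. \<Sum>k<N. w ^ n * (v ^ k * shift k a n)) sums (\<Sum>k<N. ((norm w)\<^sup>2) ^ k *\<^sub>R f w)"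
      by (intro sums_sum)
    then have "(\<lambda>n. w ^ n * b n) sums (s N *\<^sub>R f w)"
      by (simp add: b_def s_def sum_distrib_left scaleR_sum_left)
    from power_series_Cauchy_Schwarz[OF bs w1 this]
    have "(s N)\<^sup>2 * (norm (f w))\<^sup>2 \<le> s N / (1 - (norm w)\<^sup>2)"
      by (simp add: nb power_mult_distrib)
    then have "s N * (s N * (norm (f w))\<^sup>2) \<le> s N * (1 / (1 - (norm w)\<^sup>2))"
      by (simp add: power2_eq_square mult.assoc)
    moreover have "s N > 0"
      using that unfolding s_def
      by (intro sum_pos2[of _ 0]) auto
    ultimately show ?thesis
      by (meson mult_le_cancel_left_pos)
  qed
  have "(\<lambda>k. ((norm w)\<^sup>2) ^ k) sums (1 / (1 - (norm w)\<^sup>2))"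
    using w2 by (intro geometric_sums) auto
  then have "s \<longlonglongrightarrow> 1 / (1 - (norm w)\<^sup>2)"
    unfolding sums_def s_def .
  then have "(\<lambda>N. s N * (norm (f w))\<^sup>2) \<longlonglongrightarrow> 1 / (1 - (norm w)\<^sup>2) * (norm (f w))\<^sup>2"
    by (intro tendsto_intros)
  then have "1 / (1 - (norm w)\<^sup>2) * (norm (f w))\<^sup>2 \<le> 1 / (1 - (norm w)\<^sup>2)"
    by (rule LIMSEQ_le_const2) (use bound in \<open>auto intro!: exI[of _ 1]\<close>)
  then have "(norm (f w))\<^sup>2 \<le> 1"
    using w2 mult_le_cancel_left_pos[of "1 / (1 - (norm w)\<^sup>2)" "(norm (f w))\<^sup>2" 1] by simp
  then show ?thesis
    by (simp add: power_le_one_iff abs_square_le_1)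
qed

section \<open>Poisson averages and a covering argument\<close>

text \<open>The Poisson kernel of the unit disc, without the factor \<open>1 / (2 \<pi>)\<close>.\<close>

definition poisson :: "real \<Rightarrow> real \<Rightarrow> real" where
  "poisson r t = (1 - r\<^sup>2) / (1 - 2 * r * cos t + r\<^sup>2)"

lemma poisson_denom_pos:
  fixes r t :: real
  assumes "0 < r" "r < 1"
  shows "0 < 1 - 2 * r * cos t + r\<^sup>2"
proof -
  have "r * cos t \<le> r * 1" using mult_left_mono[OF cos_le_one, of r t] assms(1) by simp
  moreover have "0 < (1 - r)\<^sup>2" using assms by simp
  ultimately show ?thesis by (simp add: power2_diff)
qed

lemma poisson_minus: "poisson r (- t) = poisson r t"
  by (simp add: poisson_def)

lemma poisson_nonneg: "0 < r \<Longrightarrow> r < 1 \<Longrightarrow> 0 \<le> poisson r t"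
  using poisson_denom_pos[of r t] by (simp add: poisson_def abs_square_le_1)

lemma continuous_on_poisson:
  assumes "0 < r" "r < 1"
  shows "continuous_on A (poisson r)"
  unfolding poisson_def
  by (intro continuous_intros) (use poisson_denom_pos[OF assms] in \<open>auto simp: less_imp_neq[symmetric]\<close>)

text \<open>The kernel is \<open>1 - r\<^sup>2\<close> times the squared modulus of the geometric series \<open>\<Sum> r\<^sup>n e\<^sup>n\<^sup>t\<^sup>I\<close>, so that
  Parseval gives its mass.\<close>

lemma poisson_has_integral:
  assumes r: "0 < r" "r < 1"
  shows "(poisson r has_integral 2 * pi) {- pi..pi}"
proof -
  let ?I = "Quat 0 1 0 0"
  have I: "?I \<in> imag_units"
    by (intro imag_unitsI) (simp_all add: norm_quat_def)
  have r2: "r\<^sup>2 < 1" using r by (simp add: power_less_one_iff)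
  let ?b = "\<lambda>n. of_real (r ^ n) :: quat"
  have b: "summable (\<lambda>n. norm (?b n))"
    using r by (simp add: norm_power summable_geometric)
  have s: "(\<Sum>n. (norm (?b n))\<^sup>2) = 1 / (1 - r\<^sup>2)"
    using suminf_geometric[of "r\<^sup>2"] r r2 by (simp add: norm_power power_mult[symmetric] mult.commute)
  have "(norm (fourier ?I ?b t))\<^sup>2 * (1 - 2 * r * cos t + r\<^sup>2) = 1" for t
  proof -
    define u where "u = r *\<^sub>R qcis ?I t"
    let ?S = "fourier ?I ?b t"
    have e: "u ^ n = qcis ?I t ^ n * ?b n" for n
      unfolding u_def of_real_def scaleR_power by simp
    have us: "(\<lambda>n. u ^ n) sums ?S"
      by (rule sums_cong[THEN iffD2, OF e fourier_sums[OF I b]])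
    then have "(\<lambda>n. u ^ Suc n) sums (?S - 1)"
      by (subst sums_Suc_iff) simp
    moreover have "(\<lambda>n. u ^ Suc n) sums (u * ?S)"
      using sums_mult[OF us, of u] by simp
    ultimately have "(1 - u) * ?S = 1"
      using sums_unique2 by (fastforce simp: left_diff_distrib)
    then have "(norm (1 - u))\<^sup>2 * (norm ?S)\<^sup>2 = 1"
      by (metis norm_mult norm_one power_mult_distrib power_one)
    moreover have "(norm (1 - u))\<^sup>2 = (1 - r * cos t)\<^sup>2 + (r * sin t)\<^sup>2"
      by (simp add: u_def norm_quat_def qcis_def times_quat_def one_quat_def)
    moreover have "(1 - r * cos t)\<^sup>2 + (r * sin t)\<^sup>2 = 1 - 2 * r * cos t + r\<^sup>2"
      unfolding power_mult_distrib sin_squared_eq by (simp add: power2_eq_square algebra_simps)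
    ultimately show ?thesis by (simp add: mult.commute)
  qed
  then have "(1 - r\<^sup>2) * (norm (fourier ?I ?b t))\<^sup>2 = poisson r t" for t
    using poisson_denom_pos[OF r, of t] by (simp add: poisson_def field_simps)
  then show ?thesis
    using has_integral_mult_right[OF parseval[OF I b, of 0], of "1 - r\<^sup>2"] s r2 by simp
qed

text \<open>Multiplying the kernel by its denominator gives a three-term recurrence for the cosine
  coefficients; it starts from the total mass.\<close>

lemma poisson_cos_has_integral:
  assumes r: "0 < r" "r < 1"
  shows "((\<lambda>t. poisson r t * cos (real n * t)) has_integral 2 * pi * r ^ n) {- pi..pi}"
proof -
  have c: "((\<lambda>t. cos (real n * t)) has_integral (if n = 0 then 2 * pi else 0)) {- pi..pi}" for n
    using integral_cos_period[of "int n" 0] by simp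
  have P: "poisson r t * (2 * r * cos t) = (1 + r\<^sup>2) * poisson r t - (1 - r\<^sup>2)" for t
    using poisson_denom_pos[OF r, of t] by (simp add: poisson_def field_simps)
  have 0: "((\<lambda>t. poisson r t * cos (real 0 * t)) has_integral 2 * pi * r ^ 0) {- pi..pi}"
    using poisson_has_integral[OF r] by simp
  have 1: "((\<lambda>t. poisson r t * cos (real (Suc 0) * t)) has_integral 2 * pi * r ^ Suc 0) {- pi..pi}"
  proof -
    have "((\<lambda>t. ((1 + r\<^sup>2) * poisson r t - (1 - r\<^sup>2) * cos (real 0 * t)) * (1 / (2 * r))) has_integral
        ((1 + r\<^sup>2) * (2 * pi) - (1 - r\<^sup>2) * (2 * pi)) * (1 / (2 * r))) {- pi..pi}"
      using c[of 0]
      by (intro has_integral_mult_left has_integral_diff has_integral_mult_right poisson_has_integral r) simp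
    moreover have "((1 + r\<^sup>2) * (2 * pi) - (1 - r\<^sup>2) * (2 * pi)) * (1 / (2 * r)) = 2 * pi * r ^ Suc 0"
      using r by (simp add: field_simps power2_eq_square)
    moreover have "((1 + r\<^sup>2) * poisson r t - (1 - r\<^sup>2) * cos (real 0 * t)) * (1 / (2 * r)) =
        poisson r t * cos (real (Suc 0) * t)" for t
      using P[of t] r by (simp add: field_simps)
    ultimately show ?thesis by simp
  qed
  have step: "((\<lambda>t. poisson r t * cos (real (Suc (Suc m)) * t)) has_integral 2 * pi * r ^ Suc (Suc m)) {- pi..pi}"
    if m: "((\<lambda>t. poisson r t * cos (real m * t)) has_integral 2 * pi * r ^ m) {- pi..pi}"
     "((\<lambda>t. poisson r t * cos (real (Suc m) * t)) has_integral 2 * pi * r ^ Suc m) {- pi..pi}" for m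
  proof -
    have "((\<lambda>t. ((1 + r\<^sup>2) * (poisson r t * cos (real (Suc m) * t)) - r * (poisson r t * cos (real m * t))
          - (1 - r\<^sup>2) * cos (real (Suc m) * t)) * (1 / r)) has_integral
        ((1 + r\<^sup>2) * (2 * pi * r ^ Suc m) - r * (2 * pi * r ^ m) - (1 - r\<^sup>2) * 0) * (1 / r)) {- pi..pi}"
      using c[of "Suc m"]
      by (intro has_integral_mult_left has_integral_diff has_integral_mult_right m) simp
    moreover have "((1 + r\<^sup>2) * (2 * pi * r ^ Suc m) - r * (2 * pi * r ^ m) - (1 - r\<^sup>2) * 0) * (1 / r)
        = 2 * pi * r ^ Suc (Suc m)"
      using r by (simp add: field_simps power2_eq_square)
    moreover have "((1 + r\<^sup>2) * (poisson r t * cos (real (Suc m) * t)) - r * (poisson r t * cos (real m * t))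
          - (1 - r\<^sup>2) * cos (real (Suc m) * t)) * (1 / r) = poisson r t * cos (real (Suc (Suc m)) * t)" for t
    proof -
      have "cos (real (Suc (Suc m)) * t) + cos (real m * t) = 2 * cos t * cos (real (Suc m) * t)"
        using cos_add[of "real (Suc m) * t" t] cos_diff[of "real (Suc m) * t" t]
        by (simp add: algebra_simps)
      then have X: "cos (real (Suc (Suc m)) * t) = 2 * cos t * cos (real (Suc m) * t) - cos (real m * t)"
        by linarith
      have "r * (poisson r t * (2 * cos t * y - x))
          = (1 + r\<^sup>2) * (poisson r t * y) - r * (poisson r t * x) - (1 - r\<^sup>2) * y" for x y
      proof -
        have "r * (poisson r t * (2 * cos t * y - x))
            = (poisson r t * (2 * r * cos t)) * y - r * (poisson r t * x)"
          by (simp add: algebra_simps)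
        then show ?thesis unfolding P by (simp add: algebra_simps)
      qed
      from this[symmetric] show ?thesis
        unfolding X using r by simp
    qed
    ultimately show ?thesis by simp
  qed
  have "((\<lambda>t. poisson r t * cos (real n * t)) has_integral 2 * pi * r ^ n) {- pi..pi} \<and>
     ((\<lambda>t. poisson r t * cos (real (Suc n) * t)) has_integral 2 * pi * r ^ Suc n) {- pi..pi}"
    by (induction n) (use 0 1 step in blast)+
  then show ?thesis ..
qed

lemma poisson_sin_has_integral:
  assumes r: "0 < r" "r < 1"
  shows "((\<lambda>t. poisson r t * sin (real n * t)) has_integral 0) {- pi..pi}"
proof -
  let ?f = "\<lambda>t. poisson r t * sin (real n * t)"
  have "?f integrable_on {- pi..pi}"
    by (intro integrable_continuous_real continuous_intros continuous_on_poisson r)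
  then obtain J where J: "(?f has_integral J) {- pi..pi}" by blast
  then have "((\<lambda>t. ?f (- t)) has_integral J) {- pi..pi}"
    using has_integral_reflect_real[of ?f J pi "- pi"] unfolding minus_minus by blast
  moreover have "?f (- t) = - ?f t" for t by (simp add: poisson_def)
  ultimately have "((\<lambda>t. - ?f t) has_integral J) {- pi..pi}"
    by (simp only:)
  with has_integral_neg[OF J] have "J = - J"
    by (rule has_integral_unique[rotated])
  then have "J = 0" by simp
  with J show ?thesis by simp
qed

lemma poisson_qcis_has_integral:
  assumes I: "I \<in> imag_units" and r: "0 < r" "r < 1"
  shows "((\<lambda>t. poisson r t *\<^sub>R (qcis I t ^ n * x)) has_integral (2 * pi) *\<^sub>R (r ^ n *\<^sub>R x)) {- pi..pi}"
proof -
  have "((\<lambda>t. (poisson r t * cos (real n * t)) *\<^sub>R x + (poisson r t * sin (real n * t)) *\<^sub>R (I * x))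
      has_integral (2 * pi * r ^ n) *\<^sub>R x + 0 *\<^sub>R (I * x)) {- pi..pi}"
    by (intro has_integral_add has_integral_scaleR_left poisson_cos_has_integral poisson_sin_has_integral r)
  moreover have "poisson r t *\<^sub>R (qcis I t ^ n * x)
      = (poisson r t * cos (real n * t)) *\<^sub>R x + (poisson r t * sin (real n * t)) *\<^sub>R (I * x)" for t
    by (simp add: qcis_power[OF I]) (simp add: qcis_def of_real_def distrib_right scaleR_add_right)
  ultimately show ?thesis by simp
qed

lemma poisson_fourier_has_integral:
  assumes I: "I \<in> imag_units" and b: "summable (\<lambda>n. norm (b n))" and r: "0 < r" "r < 1"
  shows "((\<lambda>s. poisson r s *\<^sub>R fourier I b (t + s)) has_integral
    (2 * pi) *\<^sub>R fourier I (\<lambda>n. r ^ n *\<^sub>R b n) t) {- pi..pi}"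
proof -
  let ?S = "\<lambda>N s. \<Sum>n<N. qcis I (t + s) ^ n * b n"
  have e: "poisson r s *\<^sub>R ?S N s = (\<Sum>n<N. poisson r s *\<^sub>R (qcis I s ^ n * (qcis I t ^ n * b n)))" for N s
  proof -
    have "qcis I (t + s) ^ n = qcis I s ^ n * qcis I t ^ n" for n
      by (simp add: qcis_power[OF I] distrib_left qcis_add[OF I, symmetric] add.commute)
    then show ?thesis by (simp add: scaleR_sum_right mult.assoc)
  qed
  have "uniform_limit UNIV (\<lambda>N s. ?S N s) (\<lambda>s. fourier I b (t + s)) sequentially"
    using fourier_uniform_limit[OF I b] unfolding uniform_limit_iff
    by (elim all_forward imp_forward eventually_mono) auto
  then have "uniform_limit {- pi..pi} ?S (\<lambda>s. fourier I b (t + s)) sequentially"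
    by (rule uniform_limit_on_subset) simp
  moreover have "bounded ((\<lambda>s. fourier I b (t + s)) ` {- pi..pi})"
    by (rule boundedI[where B = "\<Sum>n. norm (b n)"]) (auto intro: norm_fourier_le I b)
  moreover have "bounded (poisson r ` {- pi..pi})"
    by (intro compact_imp_bounded compact_continuous_image continuous_on_poisson r) simp
  ultimately have u: "uniform_limit {- pi..pi} (\<lambda>N s. poisson r s *\<^sub>R ?S N s)
      (\<lambda>s. poisson r s *\<^sub>R fourier I b (t + s)) sequentially"
    by (intro bounded_bilinear.bounded_uniform_limit[OF bounded_bilinear_scaleR]) (auto intro: uniform_limit_intros)
  obtain A B where A: "\<And>N. ((\<lambda>s. poisson r s *\<^sub>R ?S N s) has_integral A N) {- pi..pi}"
    and B: "((\<lambda>s. poisson r s *\<^sub>R fourier I b (t + s)) has_integral B) {- pi..pi}" and AB: "A \<longlonglongrightarrow> B"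
    by (rule uniform_limit_integral[OF u])
      (auto intro!: continuous_intros continuous_on_poisson r)
  have A_eq: "A N = (2 * pi) *\<^sub>R (\<Sum>n<N. qcis I t ^ n * (r ^ n *\<^sub>R b n))" for N
  proof (rule has_integral_unique[OF A])
    show "((\<lambda>s. poisson r s *\<^sub>R ?S N s) has_integral
        (2 * pi) *\<^sub>R (\<Sum>n<N. qcis I t ^ n * (r ^ n *\<^sub>R b n))) {- pi..pi}"
      unfolding e unfolding scaleR_sum_right
    proof (intro has_integral_sum)
      fix n
      show "((\<lambda>s. poisson r s *\<^sub>R (qcis I s ^ n * (qcis I t ^ n * b n))) has_integral
          (2 * pi) *\<^sub>R (qcis I t ^ n * r ^ n *\<^sub>R b n)) {- pi..pi}"
        using poisson_qcis_has_integral[OF I r, of n "qcis I t ^ n * b n"] by simp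
    qed simp
  qed
  have "summable (\<lambda>n. norm (r ^ n *\<^sub>R b n))"
    by (rule summable_comparison_test'[OF b])
      (use r in \<open>auto simp: mult_left_le_one_le power_le_one\<close>)
  from fourier_sums[OF I this, of t] have "A \<longlonglongrightarrow> (2 * pi) *\<^sub>R fourier I (\<lambda>n. r ^ n *\<^sub>R b n) t"
    unfolding sums_def A_eq[abs_def] by (intro tendsto_intros)
  with AB B show ?thesis using LIMSEQ_unique by blast
qed

lemma integral_even_part:
  fixes F :: "real \<Rightarrow> real"
  assumes "continuous_on UNIV F" "0 \<le> c"
  shows "integral {- c..c} F = integral {0..c} (\<lambda>t. F t + F (- t))"
proof -
  have i: "F integrable_on {a..b}" for a b
    using assms(1) by (meson continuous_on_subset integrable_continuous_real subset_UNIV)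
  have "integral {- c..0} F = integral {0..c} (\<lambda>t. F (- t))"
    using Henstock_Kurzweil_Integration.integral_reflect_real[of c 0 "\<lambda>t. F (- t)"] by simp
  moreover have "(\<lambda>t. F (- t)) integrable_on {0..c}"
    by (intro integrable_continuous_real continuous_on_compose2[OF assms(1)] continuous_intros) simp
  moreover have "integral {- c..0} F + integral {0..c} F = integral {- c..c} F"
    using assms(2) by (intro Henstock_Kurzweil_Integration.integral_combine i) auto
  ultimately show ?thesis
    using i by (simp add: Henstock_Kurzweil_Integration.integral_add)
qed

text \<open>Poisson averages are dominated by averages over symmetric intervals, because the kernel decreases
  on \<open>[0, \<pi>]\<close>. With \<open>G(s)\<close> the integral of \<open>g\<close> over \<open>[t - s, t + s]\<close>, the function
  \<open>H(s) = P\<^sub>r(s) (G(s) - 2 \<lambda> s)\<close> vanishes at \<open>0\<close> and is nonpositive at \<open>\<pi>\<close>, while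
  \<open>H' \<ge> P\<^sub>r (G' - 2 \<lambda>)\<close> since \<open>P\<^sub>r' \<le> 0\<close>. Integration of this inequality gives the claim.\<close>

lemma poisson_average_le:
  fixes g :: "real \<Rightarrow> real"
  assumes r: "0 < r" "r < 1" and g: "continuous_on UNIV g"
    and le: "\<And>s. 0 < s \<Longrightarrow> s \<le> pi \<Longrightarrow> integral {t - s..t + s} g \<le> 2 * s * lam"
  shows "integral {- pi..pi} (\<lambda>s. poisson r s * g (t + s)) \<le> 2 * pi * lam"
proof -
  \<comment> \<open>The radius 4 leaves room around \<open>[t - \<pi>, t + \<pi>]\<close> for two-sided derivatives.\<close>
  obtain \<Phi> where \<Phi>: "\<And>x. x \<in> {t - 4..t + 4} \<Longrightarrow> (\<Phi> has_vector_derivative g x) (at x within {t - 4..t + 4})"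
    using antiderivative_continuous[of "t - 4" "t + 4" g] continuous_on_subset[OF g] by blast
  have \<Phi>': "(\<Phi> has_real_derivative g x) (at x)" if "\<bar>x - t\<bar> < 4" for x
  proof -
    have "(\<Phi> has_vector_derivative g x) (at x within {t - 4..t + 4})"
      by (rule \<Phi>) (use that in auto)
    then show ?thesis
      using that at_within_interior[of x "{t - 4..t + 4}"]
      by (simp add: has_real_derivative_iff_has_vector_derivative abs_less_iff)
  qed
  have pi4: "pi < 4" using pi_less_4 .
  define G where "G s = \<Phi> (t + s) - \<Phi> (t - s)" for s
  have G: "integral {t - s..t + s} g = G s" if "0 \<le> s" "s \<le> pi" for s
    unfolding G_def
    by (intro integral_unique fundamental_theorem_of_calculus)
      (use that pi4 in \<open>auto simp: has_real_derivative_iff_has_vector_derivative[symmetric]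
        intro!: has_field_derivative_at_within[OF \<Phi>']\<close>)
  have G': "(G has_real_derivative (g (t + s) + g (t - s))) (at s)" if "\<bar>s\<bar> < 4" for s
    unfolding G_def
    by (auto intro!: derivative_eq_intros DERIV_chain2[OF \<Phi>'] simp: that)
  define P' where "P' s = - ((1 - r\<^sup>2) * (2 * r * sin s)) / (1 - 2 * r * cos s + r\<^sup>2)\<^sup>2" for s
  have P': "(poisson r has_real_derivative P' s) (at s)" for s
    unfolding poisson_def P'_def using poisson_denom_pos[OF r, of s]
    by (auto intro!: derivative_eq_intros simp: power2_eq_square)
  define H where "H s = poisson r s * (G s - 2 * lam * s)" for s
  let ?D = "\<lambda>s. P' s * (G s - 2 * lam * s) + poisson r s * (g (t + s) + g (t - s) - 2 * lam)"
  have H': "(?D has_integral (H pi - H 0)) {0..pi}"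
  proof (rule fundamental_theorem_of_calculus)
    fix s assume "s \<in> {0..pi}"
    then have "\<bar>s\<bar> < 4" using pi4 by auto
    then have "(H has_real_derivative ?D s) (at s)"
      unfolding H_def by (auto intro!: derivative_eq_intros P' G' simp: algebra_simps)
    then show "(H has_vector_derivative ?D s) (at s within {0..pi})"
      by (simp add: has_real_derivative_iff_has_vector_derivative has_vector_derivative_at_within)
  qed simp
  have Gle: "G s \<le> 2 * lam * s" if "0 \<le> s" "s \<le> pi" for s
  proof (cases "s = 0")
    case True
    then show ?thesis by (simp add: G_def)
  next
    case False
    then show ?thesis using le[of s] G[of s] that by (simp add: mult_ac)
  qed
  have r2: "r\<^sup>2 \<le> 1" using r by (simp add: power_le_one_iff)
  have ct: "continuous_on A (\<lambda>s. g (t + s))" "continuous_on A (\<lambda>s. g (t - s))" for A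
    by (intro continuous_on_compose2[OF g] continuous_intros; simp)+
  have i1: "(\<lambda>s. poisson r s * (g (t + s) + g (t - s))) integrable_on {0..pi}"
    by (intro integrable_continuous_real continuous_intros continuous_on_poisson r ct)
  have i2: "(\<lambda>s. poisson r s * 2) integrable_on {0..pi}"
    by (intro integrable_continuous_real continuous_intros continuous_on_poisson r)
  have "integral {0..pi} (\<lambda>s. poisson r s * (g (t + s) + g (t - s) - 2 * lam)) \<le> H pi - H 0"
  proof (rule has_integral_le[OF integrable_integral H'])
    show "(\<lambda>s. poisson r s * (g (t + s) + g (t - s) - 2 * lam)) integrable_on {0..pi}"
      by (intro integrable_continuous_real continuous_intros continuous_on_poisson r ct)
    fix s assume s: "s \<in> {0..pi}"
    have "P' s \<le> 0"
      using s r r2 by (auto simp: P'_def sin_ge_zero intro!: divide_nonneg_nonneg mult_nonneg_nonneg)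
    then have "0 \<le> P' s * (G s - 2 * lam * s)"
      using Gle[of s] s by (intro mult_nonpos_nonpos) auto
    then show "poisson r s * (g (t + s) + g (t - s) - 2 * lam) \<le> ?D s" by simp
  qed
  also have "H pi - H 0 \<le> 0"
    using Gle[of pi] poisson_nonneg[OF r, of pi] by (simp add: H_def G_def mult_nonneg_nonpos)
  also have "integral {0..pi} (\<lambda>s. poisson r s * (g (t + s) + g (t - s) - 2 * lam)) =
     integral {0..pi} (\<lambda>s. poisson r s * (g (t + s) + g (t - s))) - integral {0..pi} (\<lambda>s. poisson r s * 2) * lam"
    unfolding integral_mult_left[symmetric]
    by (subst Henstock_Kurzweil_Integration.integral_diff[OF i1 integrable_on_mult_left[OF i2], symmetric])
      (simp add: algebra_simps)
  also have "integral {0..pi} (\<lambda>s. poisson r s * 2) = integral {- pi..pi} (poisson r)"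
    by (subst integral_even_part) (auto intro: continuous_on_poisson r simp: poisson_minus mult_2_right)
  also have "\<dots> = 2 * pi"
    using poisson_has_integral[OF r] by (rule integral_unique)
  also have "integral {0..pi} (\<lambda>s. poisson r s * (g (t + s) + g (t - s))) =
      integral {- pi..pi} (\<lambda>s. poisson r s * g (t + s))"
    by (subst integral_even_part)
      (auto intro!: continuous_intros continuous_on_poisson r ct simp: poisson_minus distrib_left)
  finally show ?thesis by simp
qed

text \<open>The weak type estimate for the symmetric maximal function, with the constant of Vitali's lemma: the
  intervals of the disjoint subfamily have total length at most \<open>1 / \<lambda>\<close> times the integral of \<open>g\<close>,
  and their fivefold enlargements cover. The conclusion is about a measurable superset, because
  measurability of the exceptional set is not needed.\<close>

lemma weak_type_interval_averages:
  fixes g :: "real \<Rightarrow> real"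
  assumes g: "continuous_on UNIV g" "\<And>x. 0 \<le> g x" and lam: "lam > 0"
  obtains B where "{t \<in> {0..2 * pi}. \<exists>s. 0 < s \<and> s \<le> pi \<and> integral {t - s..t + s} g > 2 * s * lam} \<subseteq> B"
    "B \<in> lmeasurable" "measure lebesgue B \<le> 5 / lam * integral {- pi..3 * pi} g"
proof -
  define K where "K = {(t, s). t \<in> {0..2 * pi} \<and> 0 < s \<and> s \<le> pi \<and> integral {t - s..t + s} g > 2 * s * lam}"
  let ?E = "{t \<in> {0..2 * pi}. \<exists>s. 0 < s \<and> s \<le> pi \<and> integral {t - s..t + s} g > 2 * s * lam}"
  have E: "?E \<subseteq> (\<Union>i\<in>K. cball (fst i) (snd i))"
    by (fastforce simp: K_def)
  have rad: "\<And>i. i \<in> K \<Longrightarrow> 0 < snd i \<and> snd i \<le> pi" by (auto simp: K_def)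
  obtain C where C: "countable C" "C \<subseteq> K"
     "pairwise (\<lambda>i j. disjnt (cball (fst i) (snd i)) (cball (fst j) (snd j))) C"
     "?E \<subseteq> (\<Union>i\<in>C. cball (fst i) (5 * snd i))"
    using Vitali_covering_lemma_cballs[OF E rad] by blast
  let ?B = "\<Union>i\<in>C. cball (fst i) (5 * snd i)"
  have i: "g integrable_on {a..b}" for a b
    using g(1) by (meson continuous_on_subset integrable_continuous_real subset_UNIV)
  have fin: "measure lebesgue (\<Union>i\<in>F. cball (fst i) (5 * snd i)) \<le> 5 / lam * integral {- pi..3 * pi} g"
    if F: "F \<subseteq> C" "finite F" for F
  proof -
    have "measure lebesgue (\<Union>i\<in>F. cball (fst i) (5 * snd i)) \<le> (\<Sum>i\<in>F. measure lebesgue (cball (fst i) (5 * snd i)))"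
      using F(2) by (intro measure_UNION_le) auto
    also have "\<dots> \<le> (\<Sum>i\<in>F. 5 / lam * integral (cball (fst i) (snd i)) g)"
    proof (intro sum_mono)
      fix i assume "i \<in> F"
      then have "i \<in> K" using F C by auto
      then have s: "0 < snd i" "2 * snd i * lam \<le> integral (cball (fst i) (snd i)) g"
        by (auto simp: K_def cball_eq_atLeastAtMost)
      then have "measure lebesgue (cball (fst i) (5 * snd i)) = 5 / lam * (2 * snd i * lam)"
        using lam by (simp add: cball_eq_atLeastAtMost)
      also have "\<dots> \<le> 5 / lam * integral (cball (fst i) (snd i)) g"
        using s lam by (intro mult_left_mono) auto
      finally show "measure lebesgue (cball (fst i) (5 * snd i)) \<le> 5 / lam * integral (cball (fst i) (snd i)) g" .
    qed
    also have "\<dots> = 5 / lam * (\<Sum>i\<in>F. integral (cball (fst i) (snd i)) g)"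
      by (simp add: sum_distrib_left)
    also have "\<dots> \<le> 5 / lam * integral {- pi..3 * pi} g"
    proof (intro mult_left_mono)
      have U: "(g has_integral (\<Sum>i\<in>F. integral (cball (fst i) (snd i)) g)) (\<Union>i\<in>F. cball (fst i) (snd i))"
      proof (rule has_integral_UN[OF F(2)])
        fix i :: "real \<times> real"
        show "(g has_integral integral (cball (fst i) (snd i)) g) (cball (fst i) (snd i))"
          unfolding cball_eq_atLeastAtMost by (intro integrable_integral i)
      next
        show "pairwise (\<lambda>i i'. negligible (cball (fst i) (snd i) \<inter> cball (fst i') (snd i'))) F"
          using C(3) F(1) unfolding pairwise_def disjnt_def by (metis negligible_empty subsetD)
      qed
      have "(\<Union>i\<in>F. cball (fst i) (snd i)) \<subseteq> {- pi..3 * pi}"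
        using F(1) C(2) by (fastforce simp: K_def cball_eq_atLeastAtMost)
      then show "(\<Sum>i\<in>F. integral (cball (fst i) (snd i)) g) \<le> integral {- pi..3 * pi} g"
        by (rule has_integral_subset_le[OF _ U integrable_integral[OF i]]) (use g in auto)
    qed (use lam in auto)
    finally show ?thesis .
  qed
  show thesis
  proof (rule that[OF C(4)])
    show "?B \<in> lmeasurable"
      by (rule fmeasurable_UN_bound[OF C(1) _ fin]) auto
    show "measure lebesgue ?B \<le> 5 / lam * integral {- pi..3 * pi} g"
      by (rule measure_UN_bound[OF C(1) _ fin]) auto
  qed
qed

section \<open>Radial limits on a slice\<close>

text \<open>The length of \<open>[- \<pi>, 3 \<pi>]\<close> is two periods, and over each of them the integral of the modulus is at
  most \<open>2 \<pi> \<tau>\<close> by Parseval.\<close>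

lemma weak_type_fourier:
  assumes I: "I \<in> imag_units" and b: "summable (\<lambda>n. norm (b n))"
    and tau: "tau > 0" "(\<Sum>n. (norm (b n))\<^sup>2) \<le> tau\<^sup>2" and lam: "lam > 0"
  obtains B where
    "{t \<in> {0..2 * pi}. \<exists>r. 0 < r \<and> r < 1 \<and> norm (fourier I (\<lambda>n. r ^ n *\<^sub>R b n) t) > lam} \<subseteq> B"
    "B \<in> lmeasurable" "measure lebesgue B \<le> 20 * pi * tau / lam"
proof -
  let ?g = "\<lambda>x. norm (fourier I b x)"
  have g: "continuous_on A ?g" for A
    by (intro continuous_intros continuous_on_fourier I b)
  obtain B where B: "{t \<in> {0..2 * pi}. \<exists>s. 0 < s \<and> s \<le> pi \<and> integral {t - s..t + s} ?g > 2 * s * lam} \<subseteq> B"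
    "B \<in> lmeasurable" "measure lebesgue B \<le> 5 / lam * integral {- pi..3 * pi} ?g"
    using weak_type_interval_averages[OF g _ lam] by auto
  have sub: "\<exists>s. 0 < s \<and> s \<le> pi \<and> integral {t - s..t + s} ?g > 2 * s * lam"
    if r: "0 < r" "r < 1" and gt: "norm (fourier I (\<lambda>n. r ^ n *\<^sub>R b n) t) > lam" for r t
  proof (rule ccontr)
    assume "\<not> ?thesis"
    then have le: "integral {t - s..t + s} ?g \<le> 2 * s * lam" if "0 < s" "s \<le> pi" for s
      using that by (meson not_le)
    have i: "(\<lambda>s. poisson r s *\<^sub>R fourier I b (t + s)) integrable_on {- pi..pi}"
      using poisson_fourier_has_integral[OF I b r] by blast
    have "norm ((2 * pi) *\<^sub>R fourier I (\<lambda>n. r ^ n *\<^sub>R b n) t)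
        = norm (integral {- pi..pi} (\<lambda>s. poisson r s *\<^sub>R fourier I b (t + s)))"
      using poisson_fourier_has_integral[OF I b r, of t] by (simp add: integral_unique)
    also have "\<dots> \<le> integral {- pi..pi} (\<lambda>s. poisson r s * ?g (t + s))"
    proof (rule Henstock_Kurzweil_Integration.integral_norm_bound_integral[OF i])
      show "(\<lambda>s. poisson r s * ?g (t + s)) integrable_on {- pi..pi}"
        by (intro integrable_continuous_real continuous_intros continuous_on_poisson r
            continuous_on_compose2[OF continuous_on_fourier[OF I b, of UNIV]]) auto
    qed (simp add: poisson_nonneg[OF r])
    also have "\<dots> \<le> 2 * pi * lam"
      by (rule poisson_average_le[OF r g le])
    finally show False using gt by simp
  qed
  have half: "integral {c - pi..c + pi} ?g \<le> 2 * pi * tau" for c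
  proof -
    have "((\<lambda>t. tau / 2 + (?g t)\<^sup>2 * (1 / (2 * tau))) has_integral
        ((c + pi - (c - pi)) *\<^sub>R (tau / 2) + (2 * pi * (\<Sum>n. (norm (b n))\<^sup>2)) * (1 / (2 * tau)))) {c - pi..c + pi}"
      using has_integral_const_real[of "tau / 2" "c - pi" "c + pi"]
      by (intro has_integral_add has_integral_mult_left parseval I b) auto
    \<comment> \<open>By the inequality of arithmetic and geometric means; both terms have the same integral bound.\<close>
    moreover have "?g t \<le> tau / 2 + (?g t)\<^sup>2 * (1 / (2 * tau))" for t
      using sum_squares_bound[of tau "?g t"] tau by (simp add: field_simps power2_eq_square)
    ultimately have "integral {c - pi..c + pi} ?g
        \<le> (c + pi - (c - pi)) *\<^sub>R (tau / 2) + (2 * pi * (\<Sum>n. (norm (b n))\<^sup>2)) * (1 / (2 * tau))"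
      using has_integral_le[OF integrable_integral[OF integrable_continuous_real[OF g]]] by blast
    also have "\<dots> = pi * tau + pi * (\<Sum>n. (norm (b n))\<^sup>2) / tau"
      using tau by (simp add: field_simps)
    also have "pi * (\<Sum>n. (norm (b n))\<^sup>2) / tau \<le> pi * tau\<^sup>2 / tau"
      using tau by (intro divide_right_mono mult_left_mono) auto
    finally show ?thesis using tau by (simp add: power2_eq_square)
  qed
  have "integral {- pi..3 * pi} ?g = integral {- pi..pi} ?g + integral {pi..3 * pi} ?g"
    by (rule Henstock_Kurzweil_Integration.integral_combine[symmetric])
      (auto intro!: integrable_continuous_real g)
  also have "\<dots> \<le> 4 * pi * tau"
    using half[of 0] half[of "2 * pi"] by simp
  finally have "5 / lam * integral {- pi..3 * pi} ?g \<le> 5 / lam * (4 * pi * tau)"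
    using lam by (intro mult_left_mono) auto
  then have "measure lebesgue B \<le> 20 * pi * tau / lam"
    using B(3) by simp
  moreover have "{t \<in> {0..2 * pi}. \<exists>r. 0 < r \<and> r < 1 \<and> norm (fourier I (\<lambda>n. r ^ n *\<^sub>R b n) t) > lam} \<subseteq> B"
    using sub B(1) by blast
  ultimately show thesis using that B(2) by blast
qed

text \<open>For square-summable coefficients the boundary function is avoided: the previous estimate is applied
  to the absolutely summable dilates \<open>\<rho>\<^sub>k\<^sup>n a\<^sub>n\<close>, and \<open>\<rho>\<^sub>k\<close> increases to 1.\<close>

lemma radial_maximal_inequality:
  assumes I: "I \<in> imag_units" and a: "square_summable a"
    and tau: "tau > 0" "(\<Sum>n. (norm (a n))\<^sup>2) \<le> tau\<^sup>2" and lam: "lam > 0"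
  defines "E \<equiv> {t \<in> {0..2 * pi}. \<exists>s. 0 < s \<and> s < 1 \<and> norm (fourier I (\<lambda>n. s ^ n *\<^sub>R a n) t) > lam}"
  shows "E \<in> lmeasurable" "measure lebesgue E \<le> 20 * pi * tau / lam"
proof -
  let ?u = "\<lambda>s. fourier I (\<lambda>n. s ^ n *\<^sub>R a n)"
  define \<rho> where "\<rho> k = 1 - 1 / (real k + 2)" for k
  have \<rho>: "0 < \<rho> k" "\<rho> k < 1" for k by (auto simp: \<rho>_def field_simps)
  define F where "F k = {t \<in> {0..2 * pi}. \<exists>s. 0 < s \<and> s < \<rho> k \<and> norm (?u s t) > lam}" for k
  have F_meas: "F k \<in> lmeasurable" for k
  proof -
    have "F k = {0..2 * pi} \<inter> (\<Union>s\<in>{0<..<\<rho> k}. {t. lam < norm (?u s t)})"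
      by (auto simp: F_def)
    moreover have "open (\<Union>s\<in>{0<..<\<rho> k}. {t. lam < norm (?u s t)})"
      using \<rho>[of k]
      by (intro open_UN ballI open_Collect_less continuous_intros continuous_on_fourier I summable_dilate a) auto
    ultimately show ?thesis
      by (simp add: fmeasurable_Int_fmeasurable borel_open sets_completionI_sets)
  qed
  have F_le: "measure lebesgue (F k) \<le> 20 * pi * tau / lam" for k
  proof -
    have "(\<Sum>n. (norm (\<rho> k ^ n *\<^sub>R a n))\<^sup>2) \<le> (\<Sum>n. (norm (a n))\<^sup>2)"
      using a \<rho>[of k]
      by (intro suminf_le norm_dilate_le summable_norm_square[OF summable_dilate])
        (auto simp: square_summable_def)
    then have le: "(\<Sum>n. (norm (\<rho> k ^ n *\<^sub>R a n))\<^sup>2) \<le> tau\<^sup>2" using tau by simp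
    obtain B where B:
      "{t \<in> {0..2 * pi}. \<exists>r. 0 < r \<and> r < 1 \<and> norm (fourier I (\<lambda>n. r ^ n *\<^sub>R \<rho> k ^ n *\<^sub>R a n) t) > lam} \<subseteq> B"
      "B \<in> lmeasurable" "measure lebesgue B \<le> 20 * pi * tau / lam"
      by (rule weak_type_fourier[OF I summable_dilate[OF a] tau(1) le lam])
        (use \<rho>[of k] in auto)
    have "F k \<subseteq> B"
    proof
      fix t assume "t \<in> F k"
      then obtain s where s: "t \<in> {0..2 * pi}" "0 < s" "s < \<rho> k" "norm (?u s t) > lam"
        by (auto simp: F_def)
      have "(s / \<rho> k) ^ n *\<^sub>R \<rho> k ^ n *\<^sub>R a n = s ^ n *\<^sub>R a n" for n
        using \<rho>(1)[of k] by (simp add: power_divide)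
      then have "norm (fourier I (\<lambda>n. (s / \<rho> k) ^ n *\<^sub>R \<rho> k ^ n *\<^sub>R a n) t) > lam"
        using s(4) by (simp only:)
      moreover have "0 < s / \<rho> k" "s / \<rho> k < 1"
        using s \<rho>(1)[of k] by auto
      ultimately show "t \<in> B" using B(1) s(1) by blast
    qed
    then show ?thesis
      using measure_mono_fmeasurable[of "F k" B lebesgue] B F_meas[of k] fmeasurableD by force
  qed
  have mono: "F i \<subseteq> F j" if "i \<le> j" for i j
  proof -
    have "\<rho> i \<le> \<rho> j" using that by (auto simp: \<rho>_def intro!: divide_left_mono)
    then show ?thesis by (force simp: F_def)
  qed
  have "(\<Union>i\<le>n. F i) = F n" for n
    using mono by (auto; blast)
  then have U: "measure lebesgue (\<Union>i\<le>n. F i) \<le> 20 * pi * tau / lam" for n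
    using F_le by simp
  have "E = (\<Union>k. F k)"
  proof (intro equalityI subsetI)
    fix t assume "t \<in> E"
    then obtain s where s: "t \<in> {0..2 * pi}" "0 < s" "s < 1" "norm (?u s t) > lam"
      by (auto simp: E_def)
    obtain k where "1 / real (Suc k) < 1 - s"
      using nat_approx_posE[of "1 - s"] s(3) by auto
    moreover have "1 / (real k + 2) \<le> 1 / real (Suc k)"
      by (intro divide_left_mono) auto
    ultimately have "s < \<rho> k" by (simp add: \<rho>_def)
    then show "t \<in> (\<Union>k. F k)" using s by (auto simp: F_def)
  next
    fix t assume "t \<in> (\<Union>k. F k)"
    then obtain k s where "t \<in> {0..2 * pi}" "0 < s" "s < \<rho> k" "norm (?u s t) > lam"
      by (auto simp: F_def)
    then show "t \<in> E" using \<rho>(2)[of k] by (auto simp: E_def)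
  qed
  then show "E \<in> lmeasurable" "measure lebesgue E \<le> 20 * pi * tau / lam"
    using fmeasurable_countable_Union[OF F_meas U] measure_countable_Union_le[OF F_meas U] by simp_all
qed

text \<open>A Cauchy criterion: in a complete space, limits up to every error yield a limit.\<close>

lemma convergent_of_approx_limits:
  fixes h :: "'b \<Rightarrow> 'a :: {complete_space}"
  assumes F: "F \<noteq> bot" and approx: "\<And>m. \<exists>l. \<forall>\<^sub>F x in F. dist (h x) l \<le> 1 / (real m + 1)"
  shows "\<exists>l. (h \<longlongrightarrow> l) F"
proof -
  have "cauchy_filter (filtermap h F)"
    unfolding cauchy_filter_metric_filtermap
  proof (intro allI impI)
    fix e :: real assume "e > 0"
    then obtain m where m: "1 / (real m + 1) < e / 2"
      using nat_approx_posE[of "e / 2"] by (auto simp: add.commute)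
    obtain l where l: "\<forall>\<^sub>F x in F. dist (h x) l \<le> 1 / (real m + 1)" using approx by blast
    have "dist (h x) (h y) < e" if "dist (h x) l \<le> 1 / (real m + 1)" "dist (h y) l \<le> 1 / (real m + 1)" for x y
      using that m dist_triangle2[of "h x" "h y" l] by linarith
    with l show "\<exists>P. eventually P F \<and> (\<forall>x y. P x \<and> P y \<longrightarrow> dist (h x) (h y) < e)" by blast
  qed
  then have "\<exists>c. filtermap h F \<le> nhds c"
    by (rule cauchy_filter_complete_converges[where A = UNIV])
      (use F in \<open>auto simp: complete_UNIV filtermap_bot_iff\<close>)
  then show ?thesis by (simp add: filterlim_def)
qed

text \<open>The exceptional set for the error \<open>1 / (m + 1)\<close> is contained in the set where the maximal function of
  a tail of the series is large; the remaining polynomial part converges everywhere.\<close>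

theorem fatou_radial_limits:
  assumes I: "I \<in> imag_units" and a: "square_summable a"
  shows "negligible {t \<in> {0..2 * pi}. \<nexists>l. ((\<lambda>s. fourier I (\<lambda>n. s ^ n *\<^sub>R a n) t) \<longlongrightarrow> l) (at_left 1)}"
proof -
  let ?u = "\<lambda>a s. fourier I (\<lambda>n. s ^ n *\<^sub>R a n)"
  define Bad where "Bad m = {t \<in> {0..2 * pi}. \<nexists>l. \<forall>\<^sub>F s in at_left 1. dist (?u a s t) l \<le> 1 / (real m + 1)}" for m
  have "negligible (Bad m)" for m
    unfolding negligible_outer_le
  proof (intro allI impI)
    fix e :: real assume e: "e > 0"
    define lam where "lam = 1 / (2 * (real m + 1))"
    have lam: "lam > 0" by (simp add: lam_def)
    \<comment> \<open>Chosen so that the maximal inequality bounds the measure by \<open>e\<close>.\<close>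
    define tau where "tau = e * lam / (20 * pi)"
    have tau: "tau > 0" using e lam by (simp add: tau_def)
    obtain N where N: "norm (\<Sum>i. (norm (a (i + N)))\<^sup>2) < tau\<^sup>2"
      using suminf_exist_split[of "tau\<^sup>2" "\<lambda>n. (norm (a n))\<^sup>2"] tau a by (auto simp: square_summable_def)
    define p where "p n = (if n < N then a n else 0)" for n
    define b where "b n = (if n < N then 0 else a n)" for n
    have p: "square_summable p"
      unfolding square_summable_def by (rule summable_finite[of "{..<N}"]) (auto simp: p_def)
    have b: "square_summable b"
      unfolding square_summable_def
      by (rule summable_comparison_test'[OF a[unfolded square_summable_def]]) (auto simp: b_def)
    have "(\<Sum>n. (norm (b n))\<^sup>2) = (\<Sum>n. (norm (b (n + N)))\<^sup>2)"
      using suminf_split_initial_segment[of "\<lambda>n. (norm (b n))\<^sup>2" N] b by (simp add: square_summable_def b_def)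
    also have "\<dots> \<le> tau\<^sup>2" using N by (simp add: b_def)
    finally have bt: "(\<Sum>n. (norm (b n))\<^sup>2) \<le> tau\<^sup>2" .
    define E where "E = {t \<in> {0..2 * pi}. \<exists>s. 0 < s \<and> s < 1 \<and> norm (?u b s t) > lam}"
    have E: "E \<in> lmeasurable" "measure lebesgue E \<le> 20 * pi * tau / lam"
      unfolding E_def by (rule radial_maximal_inequality[OF I b tau bt lam])+
    have "20 * pi * tau / lam = e" using lam by (simp add: tau_def)
    moreover have "Bad m \<subseteq> E"
    proof
      fix t assume t: "t \<in> Bad m"
      show "t \<in> E"
      proof (rule ccontr)
        assume "t \<notin> E"
        then have small: "norm (?u b s t) \<le> lam" if "0 < s" "s < 1" for s
          using t that by (force simp: E_def Bad_def)
        have p_eq: "?u p s t = (\<Sum>n<N. qcis I t ^ n * s ^ n *\<^sub>R a n)" for s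
          unfolding fourier_def by (subst suminf_finite[of "{..<N}"]) (auto simp: p_def)
        have "((\<lambda>s. ?u p s t) \<longlongrightarrow> ?u p 1 t) (at_left 1)"
          unfolding p_eq by (intro tendsto_intros)
        then have "\<forall>\<^sub>F s in at_left 1. dist (?u p s t) (?u p 1 t) < lam"
          using lam by (rule tendstoD)
        moreover have "\<forall>\<^sub>F s in at_left (1::real). s \<in> {0<..<1}"
          by (rule eventually_at_left_real) simp
        ultimately have "\<forall>\<^sub>F s in at_left 1. dist (?u a s t) (?u p 1 t) \<le> 1 / (real m + 1)"
        proof eventually_elim
          case (elim s)
          have "(\<lambda>n. qcis I t ^ n * s ^ n *\<^sub>R p n + qcis I t ^ n * s ^ n *\<^sub>R b n) sums (?u p s t + ?u b s t)"
            using elim by (intro sums_add fourier_sums I summable_dilate p b) auto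
          moreover have "qcis I t ^ n * s ^ n *\<^sub>R p n + qcis I t ^ n * s ^ n *\<^sub>R b n = qcis I t ^ n * s ^ n *\<^sub>R a n" for n
            by (simp add: p_def b_def)
          ultimately have "?u a s t = ?u p s t + ?u b s t"
            by (simp add: fourier_def sums_iff)
          then have "dist (?u a s t) (?u p 1 t) \<le> dist (?u p s t) (?u p 1 t) + norm (?u b s t)"
            using norm_triangle_ineq[of "?u p s t - ?u p 1 t" "?u b s t"]
            by (simp only: dist_norm) (simp only: add_diff_eq diff_add_eq)
          also have "\<dots> \<le> lam + lam" using elim small[of s] by (intro add_mono) auto
          also have "\<dots> = 1 / (real m + 1)" by (simp add: lam_def field_simps)
          finally show ?case .
        qed
        then show False using t by (auto simp: Bad_def)
      qed
    qed
    ultimately show "\<exists>T. Bad m \<subseteq> T \<and> T \<in> lmeasurable \<and> measure lebesgue T \<le> e"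
      using E by auto
  qed
  then have "negligible (\<Union>m. Bad m)" by (rule negligible_Union_nat)
  moreover have "{t \<in> {0..2 * pi}. \<nexists>l. ((\<lambda>s. ?u a s t) \<longlongrightarrow> l) (at_left 1)} \<subseteq> (\<Union>m. Bad m)"
    using convergent_of_approx_limits[of "at_left (1::real)"] by (force simp: Bad_def)
  ultimately show ?thesis by (rule negligible_subset)
qed

section \<open>Boundary values and inner functions\<close>

lemma AE_scale_measure_iff:
  assumes "c \<noteq> 0"
  shows "(AE x in scale_measure c M. P x) \<longleftrightarrow> (AE x in M. P x)"
  using assms by (simp add: eventually_ae_filter null_sets_def space_scale_measure)

lemma sets_sphere_area [measurable_cong]: "sets sphere_area = sets borel"
  by (simp add: sphere_area_def)

lemma space_sphere_area: "space sphere_area = UNIV"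
  by (simp add: sphere_area_def)

lemma AE_sphere_area_imag_units: "AE I in sphere_area. I \<in> imag_units"
proof -
  have "closed imag_units"
    unfolding imag_units_def by (intro closed_Collect_eq continuous_intros)
  then have "imag_units \<in> sets borel"
    by (rule borel_closed)
  let ?p = "\<lambda>(\<theta>::real, \<phi>::real). Quat 0 (sin \<theta> * cos \<phi>) (sin \<theta> * sin \<phi>) (cos \<theta>)"
  have "?p x \<in> imag_units" for x
  proof (cases x)
    case (Pair \<theta> \<phi>)
    have "(sin \<theta> * cos \<phi>)\<^sup>2 + (sin \<theta> * sin \<phi>)\<^sup>2 + (cos \<theta>)\<^sup>2
        = (sin \<theta>)\<^sup>2 * ((cos \<phi>)\<^sup>2 + (sin \<phi>)\<^sup>2) + (cos \<theta>)\<^sup>2"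
      by (simp add: power_mult_distrib distrib_left del: sin_cos_squared_add sin_cos_squared_add2)
    then show ?thesis
      using Pair by (intro imag_unitsI) (simp_all add: norm_quat_def)
  qed
  with \<open>imag_units \<in> sets borel\<close> show ?thesis
    unfolding sphere_area_def
    by (subst AE_distr_iff) (use sphere_param_measurable in \<open>auto simp: borel_prod\<close>)
qed

text \<open>Lebesgue measure for the angle on a slice.\<close>

abbreviation circle_measure :: "real measure" where
  "circle_measure \<equiv> restrict_space lborel {0..<2 * pi}"

lemma finite_measure_circle: "finite_measure circle_measure"
  by (intro finite_measureI) (simp add: emeasure_restrict_space space_restrict_space)

lemma finite_measure_sphere_area: "finite_measure sphere_area"
  by (intro finite_measureI) (simp add: space_sphere_area emeasure_sphere_area)

lemma pair_sigma_finite_sphere_circle: "pair_sigma_finite sphere_area circle_measure"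
  unfolding pair_sigma_finite_def
  by (intro conjI finite_measure.axioms(1) finite_measure_sphere_area finite_measure_circle)

lemma boundary_param_measurable:
  "(\<lambda>(I, t). qcis I t) \<in> borel_measurable (sphere_area \<Otimes>\<^sub>M circle_measure)"
proof -
  have [measurable]: "(\<lambda>t. t) \<in> borel_measurable circle_measure"
    by (intro measurable_restrict_space1) simp
  show ?thesis unfolding case_prod_beta qcis_def by measurable
qed

lemma AE_boundary_measure_iff_distr:
  "(AE q in boundary_measure. P q) \<longleftrightarrow>
   (AE q in distr (sphere_area \<Otimes>\<^sub>M circle_measure) borel (\<lambda>(I, t). qcis I t). P q)"
  unfolding boundary_measure_def qcis_def by (rule AE_scale_measure_iff) simp

text \<open>The closed interval is the one on which Parseval's identity is integrated; the endpoint is a null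
  set.\<close>

lemma AE_circle_iff_negligible:
  "(AE t in circle_measure. P t) \<longleftrightarrow> negligible {t \<in> {0..2 * pi}. \<not> P t}"
proof -
  have "(AE t in circle_measure. P t) \<longleftrightarrow> (AE t in lborel. t \<in> {0..<2 * pi} \<longrightarrow> P t)"
    by (rule AE_restrict_space_iff) simp
  also have "\<dots> \<longleftrightarrow> (AE t in lebesgue. t \<in> {0..<2 * pi} \<longrightarrow> P t)"
    by (simp only: AE_completion_iff)
  also have "\<dots> \<longleftrightarrow> negligible {t \<in> {0..<2 * pi}. \<not> P t}"
    unfolding eventually_ae_filter_negligible
    by (auto intro: negligible_subset)
  also have "\<dots> \<longleftrightarrow> negligible {t \<in> {0..2 * pi}. \<not> P t}"
  proof
    assume "negligible {t \<in> {0..<2 * pi}. \<not> P t}"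
    then have "negligible (insert (2 * pi) {t \<in> {0..<2 * pi}. \<not> P t})" by simp
    then show "negligible {t \<in> {0..2 * pi}. \<not> P t}" by (rule negligible_subset) auto
  qed (auto elim: negligible_subset)
  finally show ?thesis .
qed

text \<open>A property that holds almost everywhere on the boundary holds almost everywhere on some slice.\<close>

lemma AE_boundary_measureD:
  assumes "AE q in boundary_measure. P q"
  shows "\<exists>I\<in>imag_units. negligible {t \<in> {0..2 * pi}. \<not> P (qcis I t)}"
proof -
  interpret pair_sigma_finite sphere_area circle_measure
    by (rule pair_sigma_finite_sphere_circle)
  have "AE x in sphere_area \<Otimes>\<^sub>M circle_measure. P ((\<lambda>(I, t). qcis I t) x)"
    using assms unfolding AE_boundary_measure_iff_distr by (rule AE_distrD[OF boundary_param_measurable])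
  then have "AE I in sphere_area. AE t in circle_measure. P (qcis I t)"
    by (auto dest: AE_pair)
  with AE_sphere_area_imag_units
  have "AE I in sphere_area. I \<in> imag_units \<and> (AE t in circle_measure. P (qcis I t))"
    by eventually_elim simp
  moreover have "ae_filter sphere_area \<noteq> bot"
    by (simp add: ae_filter_eq_bot_iff space_sphere_area emeasure_sphere_area)
  ultimately have "\<exists>I. I \<in> imag_units \<and> (AE t in circle_measure. P (qcis I t))"
    by (rule eventually_happens'[rotated])
  then show ?thesis by (simp add: AE_circle_iff_negligible Bex_def)
qed

text \<open>A property that holds almost everywhere on every slice holds almost everywhere on the boundary,
  provided that it contains a Borel property with the same feature.\<close>

lemma AE_boundary_measureI:
  assumes A: "A \<in> sets borel" and sub: "\<And>q. q \<in> A \<Longrightarrow> P q"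
    and ae: "\<And>I. I \<in> imag_units \<Longrightarrow> negligible {t \<in> {0..2 * pi}. qcis I t \<notin> A}"
  shows "AE q in boundary_measure. P q"
proof -
  interpret pair_sigma_finite sphere_area circle_measure
    by (rule pair_sigma_finite_sphere_circle)
  let ?M = "sphere_area \<Otimes>\<^sub>M circle_measure"
  have "AE x in ?M. (\<lambda>(I, t). qcis I t) x \<in> A"
  proof (rule AE_pair_measure)
    show "{x \<in> space ?M. (\<lambda>(I, t). qcis I t) x \<in> A} \<in> sets ?M"
      using measurable_sets[OF boundary_param_measurable A] by (simp add: vimage_def Int_def conj_commute)
    show "AE I in sphere_area. AE t in circle_measure. (\<lambda>(I, t). qcis I t) (I, t) \<in> A"
      using AE_sphere_area_imag_units
      by eventually_elim (use ae in \<open>simp add: AE_circle_iff_negligible\<close>)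
  qed
  then have "AE q in distr ?M borel (\<lambda>(I, t). qcis I t). q \<in> A"
    using A by (subst AE_distr_iff[OF boundary_param_measurable]) auto
  then have "AE q in boundary_measure. q \<in> A"
    by (simp add: AE_boundary_measure_iff_distr)
  then show ?thesis by (rule AE_mp) (simp add: sub)
qed

lemma continuous_on_dilate:
  assumes f: "power_series_on_ball f a" "square_summable a" and r: "0 < r" "r < 1"
  shows "continuous_on (sphere 0 1) (\<lambda>q. f (r *\<^sub>R q))"
proof -
  have "uniform_limit (sphere 0 1) (\<lambda>N q. \<Sum>n<N. (r *\<^sub>R q) ^ n * a n) (\<lambda>q. \<Sum>n. (r *\<^sub>R q) ^ n * a n) sequentially"
    by (rule Weierstrass_m_test[OF _ summable_dilate[OF f(2)]])
      (use r in \<open>auto simp: norm_mult norm_power power_mult_distrib\<close>)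
  then have "continuous_on (sphere 0 1) (\<lambda>q. \<Sum>n. (r *\<^sub>R q) ^ n * a n)"
    by (rule uniform_limit_theorem[rotated]) (auto intro!: always_eventually continuous_intros)
  moreover have "(\<Sum>n. (r *\<^sub>R q) ^ n * a n) = f (r *\<^sub>R q)" if "q \<in> sphere 0 1" for q
  proof -
    have "r *\<^sub>R q \<in> \<bool>" using r that by simp
    then have "(\<lambda>n. (r *\<^sub>R q) ^ n * a n) sums f (r *\<^sub>R q)"
      using f(1) unfolding power_series_on_ball_def by blast
    then show ?thesis by (rule sums_unique[symmetric])
  qed
  ultimately show ?thesis
    by (subst continuous_on_cong[OF refl, symmetric])
qed

text \<open>Convergence to a point of the unit sphere, written with countably many quantifiers over \<open>m\<close> and \<open>j\<close>
  in front of closed conditions on the values of \<open>h\<close>. The length \<open>1 / (j + 2)\<close> keeps the radii positive.\<close>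

lemma unit_limit_iff:
  fixes h :: "real \<Rightarrow> quat"
  shows "(\<exists>l. (h \<longlongrightarrow> l) (at_left 1) \<and> norm l = 1) \<longleftrightarrow>
    (\<forall>m. \<exists>j. \<forall>r\<in>{1 - 1 / (real j + 2)<..<1}. \<forall>r'\<in>{1 - 1 / (real j + 2)<..<1}.
       dist (h r) (h r') \<le> 1 / (real m + 1) \<and> \<bar>norm (h r) - 1\<bar> \<le> 1 / (real m + 1))"
    (is "?L \<longleftrightarrow> ?R")
proof
  assume ?L
  then obtain l where l: "(h \<longlongrightarrow> l) (at_left 1)" "norm l = 1" by blast
  show ?R
  proof
    fix m :: nat
    define e where "e = 1 / (real m + 1)"
    have e: "e > 0" by (simp add: e_def)
    have "\<forall>\<^sub>F r in at_left 1. dist (h r) l < e / 2"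
      using l(1) by (rule tendstoD) (use e in simp)
    then obtain b where b: "b < 1" "\<And>r. b < r \<Longrightarrow> r < 1 \<Longrightarrow> dist (h r) l < e / 2"
      unfolding eventually_at_left_field by auto
    obtain j where "1 / real (Suc j) < 1 - b"
      using nat_approx_posE[of "1 - b"] b(1) by auto
    moreover have "1 / (real j + 2) \<le> 1 / real (Suc j)"
      by (intro divide_left_mono) auto
    ultimately have j: "b < 1 - 1 / (real j + 2)" by simp
    show "\<exists>j. \<forall>r\<in>{1 - 1 / (real j + 2)<..<1}. \<forall>r'\<in>{1 - 1 / (real j + 2)<..<1}.
       dist (h r) (h r') \<le> 1 / (real m + 1) \<and> \<bar>norm (h r) - 1\<bar> \<le> 1 / (real m + 1)"
      unfolding e_def[symmetric]
    proof (intro exI ballI conjI)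
      fix r r' assume r: "r \<in> {1 - 1 / (real j + 2)<..<1}" "r' \<in> {1 - 1 / (real j + 2)<..<1}"
      then have d: "dist (h r) l < e / 2" "dist (h r') l < e / 2"
        using b(2) j by auto
      then show "dist (h r) (h r') \<le> e"
        using dist_triangle2[of "h r" "h r'" l] by linarith
      show "\<bar>norm (h r) - 1\<bar> \<le> e"
        using d(1) e norm_triangle_ineq3[of "h r" l] l(2) by (simp add: dist_norm)
    qed
  qed
next
  assume R: ?R
  have ev: "\<forall>\<^sub>F r in at_left (1::real). r \<in> {1 - 1 / (real j + 2)<..<1}" for j
    by (rule eventually_at_left_real) simp
  have "\<exists>l. \<forall>\<^sub>F r in at_left 1. dist (h r) l \<le> 1 / (real m + 1)" for m
  proof -
    obtain j where j: "\<forall>r\<in>{1 - 1 / (real j + 2)<..<1}. \<forall>r'\<in>{1 - 1 / (real j + 2)<..<1}.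
       dist (h r) (h r') \<le> 1 / (real m + 1)" using R by meson
    obtain r' where "r' \<in> {1 - 1 / (real j + 2)<..<1}"
      using eventually_happens'[OF _ ev] trivial_limit_at_left_real by blast
    then have "\<forall>\<^sub>F r in at_left 1. dist (h r) (h r') \<le> 1 / (real m + 1)"
      using ev[of j] j by (auto elim: eventually_mono)
    then show ?thesis by blast
  qed
  then obtain l where l: "(h \<longlongrightarrow> l) (at_left 1)"
    using convergent_of_approx_limits[of "at_left (1::real)" h] by auto
  have "\<bar>norm l - 1\<bar> \<le> 1 / (real m + 1)" for m
  proof (rule tendsto_upperbound)
    show "((\<lambda>r. \<bar>norm (h r) - 1\<bar>) \<longlongrightarrow> \<bar>norm l - 1\<bar>) (at_left 1)"
      by (intro tendsto_intros l)
    obtain j where j: "\<forall>r\<in>{1 - 1 / (real j + 2)<..<1}. \<forall>r'\<in>{1 - 1 / (real j + 2)<..<1}.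
       \<bar>norm (h r) - 1\<bar> \<le> 1 / (real m + 1)" using R by meson
    show "\<forall>\<^sub>F r in at_left 1. \<bar>norm (h r) - 1\<bar> \<le> 1 / (real m + 1)"
      using ev[of j] by (rule eventually_mono) (use j in blast)
  qed simp
  then have "norm l = 1"
    using nat_approx_posE[of "\<bar>norm l - 1\<bar>"]
    by (metis Suc_eq_plus1 not_le of_nat_1 of_nat_add zero_less_abs_iff eq_iff_diff_eq_0)
  with l show ?L by blast
qed

text \<open>For fixed \<open>m\<close> and \<open>j\<close> the conditions of \<open>unit_limit_iff\<close> define an intersection of closed subsets of
  the unit sphere, so no reduction to rational radii is needed.\<close>

lemma radial_limit_set_borel:
  assumes f: "power_series_on_ball f a" "square_summable a"
  shows "{q \<in> sphere 0 1. \<exists>l. has_radial_limit f q l \<and> norm l = 1} \<in> sets borel"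
proof -
  define J where "J j = {1 - 1 / (real j + 2)<..<1}" for j
  have J: "0 < r \<and> r < 1" if "r \<in> J j" for r j
  proof -
    have "1 / (real j + 2) < 1" by simp
    with that show ?thesis unfolding J_def greaterThanLessThan_iff by linarith
  qed
  define C where "C m j = (\<Inter>r\<in>J j. \<Inter>r'\<in>J j.
     {q \<in> sphere 0 1. dist (f (r *\<^sub>R q)) (f (r' *\<^sub>R q)) \<le> 1 / (real m + 1)} \<inter>
     {q \<in> sphere 0 1. \<bar>norm (f (r *\<^sub>R q)) - 1\<bar> \<le> 1 / (real m + 1)})" for m j :: nat
  have "closed (C m j)" for m j
    unfolding C_def
    by (intro closed_INT ballI closed_Int continuous_on_closed_Collect_le continuous_intros
        continuous_on_dilate[OF f]) (auto dest: J)
  then have "sphere 0 1 \<inter> (\<Inter>m. \<Union>j. C m j) \<in> sets borel"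
    by (intro sets.Int sets.countable_INT' sets.countable_UN) (auto intro: borel_closed)
  moreover have C_iff: "q \<in> C m j \<longleftrightarrow> (\<forall>r\<in>J j. \<forall>r'\<in>J j.
      dist (f (r *\<^sub>R q)) (f (r' *\<^sub>R q)) \<le> 1 / (real m + 1) \<and>
      \<bar>norm (f (r *\<^sub>R q)) - 1\<bar> \<le> 1 / (real m + 1))" if "q \<in> sphere 0 1" for q m j
    using that unfolding C_def by blast
  have "q \<in> (\<Inter>m. \<Union>j. C m j) \<longleftrightarrow> (\<exists>l. has_radial_limit f q l \<and> norm l = 1)" if "q \<in> sphere 0 1" for q
    unfolding has_radial_limit_def unit_limit_iff J_def[symmetric] C_iff[OF that, symmetric]
    by simp
  then have "sphere 0 1 \<inter> (\<Inter>m. \<Union>j. C m j) = {q \<in> sphere 0 1. \<exists>l. has_radial_limit f q l \<and> norm l = 1}"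
    by blast
  ultimately show ?thesis by simp
qed

lemma slice_limit_iff:
  assumes f: "power_series_on_ball f a" and I: "I \<in> imag_units"
  shows "has_radial_limit f (qcis I t) l \<longleftrightarrow>
     ((\<lambda>s. fourier I (\<lambda>n. s ^ n *\<^sub>R a n) t) \<longlongrightarrow> l) (at_left 1)"
  unfolding has_radial_limit_def
proof (rule tendsto_cong)
  have "\<forall>\<^sub>F s in at_left (1::real). s \<in> {0<..<1}"
    by (rule eventually_at_left_real) simp
  then show "\<forall>\<^sub>F s in at_left 1. f (s *\<^sub>R qcis I t) = fourier I (\<lambda>n. s ^ n *\<^sub>R a n) t"
    by eventually_elim (simp add: slice_eq_fourier[OF f I])
qed

lemma negligible_of_integral_nonpos:
  fixes h :: "real \<Rightarrow> real"
  assumes h: "h integrable_on S" "\<And>t. t \<in> S \<Longrightarrow> 0 \<le> h t" and le: "integral S h \<le> 0"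
  shows "negligible {t \<in> S. h t \<noteq> 0}"
proof -
  let ?h = "\<lambda>t. if t \<in> S then h t else 0"
  have "integral S h = 0"
    using le Henstock_Kurzweil_Integration.integral_nonneg[OF h] by simp
  then have "(?h has_integral 0) UNIV"
    using h(1) has_integral_restrict_UNIV[of S h 0] by (metis has_integral_integral)
  then have "?h \<in> borel_measurable lebesgue" "integral\<^sup>N lebesgue ?h = 0"
    by (subst (asm) has_integral_iff_nn_integral_lebesgue; use h in auto)+
  then have "AE t in lebesgue. ennreal (?h t) = 0"
    by (subst (asm) nn_integral_0_iff_AE) auto
  then obtain N where "negligible N" "{t. \<not> ennreal (?h t) = 0} \<subseteq> N"
    unfolding eventually_ae_filter_negligible by blast
  moreover have "{t \<in> S. h t \<noteq> 0} \<subseteq> {t. \<not> ennreal (?h t) = 0}"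
    using h(2) by (auto simp: ennreal_eq_0_iff order_antisym_conv)
  ultimately show ?thesis by (meson negligible_subset)
qed

text \<open>Dominated convergence of Parseval's identity along the radii \<open>1 - 1 / (k + 2)\<close>. On the exceptional
  null set both the limit and the integrands are given modulus one, so that convergence holds at every
  point.\<close>

lemma bounded_slice_limit:
  assumes f: "power_series_on_ball f a" "square_summable a" and I: "I \<in> imag_units"
    and le: "\<And>q. q \<in> \<bool> \<Longrightarrow> norm (f q) \<le> 1"
    and N: "negligible N" and lim: "\<And>t. t \<in> {0..2 * pi} - N \<Longrightarrow> has_radial_limit f (qcis I t) (L t)"
    and L: "\<And>t. t \<in> N \<Longrightarrow> norm (L t) = 1"
  defines "\<rho> \<equiv> \<lambda>k. 1 - 1 / (real k + 2)"
  shows "(\<lambda>t. (norm (L t))\<^sup>2) integrable_on {0..2 * pi}"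
    "(\<lambda>k. 2 * pi * (\<Sum>n. (norm (\<rho> k ^ n *\<^sub>R a n))\<^sup>2)) \<longlonglongrightarrow> integral {0..2 * pi} (\<lambda>t. (norm (L t))\<^sup>2)"
proof -
  have \<rho>: "0 < \<rho> k" "\<rho> k < 1" for k by (auto simp: \<rho>_def field_simps)
  have "\<rho> \<longlonglongrightarrow> 1 - 0"
    unfolding \<rho>_def
    by (intro tendsto_diff tendsto_const) (use LIMSEQ_ignore_initial_segment[OF lim_1_over_n[where 'a = real], of 2] in \<open>simp add: add.commute\<close>)
  then have \<rho>_lim: "filterlim \<rho> (at_left 1) sequentially"
    using \<rho>(2) by (auto simp: filterlim_at less_imp_neq)
  define F where "F k t = (if t \<in> N then 1 else (norm (f (\<rho> k *\<^sub>R qcis I t)))\<^sup>2)" for k t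
  have F: "(F k has_integral 2 * pi * (\<Sum>n. (norm (\<rho> k ^ n *\<^sub>R a n))\<^sup>2)) {0..2 * pi}" for k
    by (rule has_integral_spike[OF N])
      (use parseval_slice[OF f I, of "\<rho> k" pi] \<rho>[of k] in \<open>auto simp: F_def\<close>)
  have bd: "norm (F k t) \<le> 1" for k t
  proof -
    have "norm (f (\<rho> k *\<^sub>R qcis I t)) \<le> 1"
      by (rule le[OF slice_point_in_ball[OF I]]) (use \<rho>[of k] in auto)
    then show ?thesis by (simp add: F_def power_le_one)
  qed
  have conv: "(\<lambda>k. F k t) \<longlonglongrightarrow> (norm (L t))\<^sup>2" if "t \<in> {0..2 * pi}" for t
  proof (cases "t \<in> N")
    case True
    then show ?thesis by (simp add: F_def L)
  next
    case False
    have "((\<lambda>s. f (s *\<^sub>R qcis I t)) \<longlongrightarrow> L t) (at_left 1)"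
      using lim[of t] that False by (simp add: has_radial_limit_def)
    from filterlim_compose[OF this \<rho>_lim]
    show ?thesis using False unfolding F_def by (simp add: tendsto_intros)
  qed
  have F_int: "F k integrable_on {0..2 * pi}" for k
    using F by blast
  have "(\<lambda>_. 1 :: real) integrable_on {0..2 * pi}"
    by (rule integrable_const_ivl)
  note dc = dominated_convergence[OF F_int this bd conv]
  show "(\<lambda>t. (norm (L t))\<^sup>2) integrable_on {0..2 * pi}" by (rule dc(1))
  have "integral {0..2 * pi} (F k) = 2 * pi * (\<Sum>n. (norm (\<rho> k ^ n *\<^sub>R a n))\<^sup>2)" for k
    using F by (rule integral_unique)
  then show "(\<lambda>k. 2 * pi * (\<Sum>n. (norm (\<rho> k ^ n *\<^sub>R a n))\<^sup>2)) \<longlonglongrightarrow> integral {0..2 * pi} (\<lambda>t. (norm (L t))\<^sup>2)"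
    using dc(2) by simp
qed

lemma sum_square_eq_1_of_unit_limits:
  assumes f: "power_series_on_ball f a" "square_summable a"
    and le: "\<And>q. q \<in> \<bool> \<Longrightarrow> norm (f q) \<le> 1"
    and ae: "AE q in boundary_measure. \<exists>l. has_radial_limit f q l \<and> norm l = 1"
  shows "(\<Sum>n. (norm (a n))\<^sup>2) = 1"
proof (rule antisym)
  show "(\<Sum>n. (norm (a n))\<^sup>2) \<le> 1"
    using sum_square_le_of_bounded[OF f le] by simp
  obtain I where I: "I \<in> imag_units"
    and neg: "negligible {t \<in> {0..2 * pi}. \<nexists>l. has_radial_limit f (qcis I t) l \<and> norm l = 1}" (is "negligible ?N")
    using AE_boundary_measureD[OF ae] by blast
  obtain L where L: "\<And>t. t \<in> {0..2 * pi} - ?N \<Longrightarrow> has_radial_limit f (qcis I t) (L t) \<and> norm (L t) = 1"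
    using bchoice[of "{0..2 * pi} - ?N" "\<lambda>t l. has_radial_limit f (qcis I t) l \<and> norm l = 1"] by blast
  let ?L = "\<lambda>t. if t \<in> {0..2 * pi} - ?N then L t else 1"
  define \<rho> where "\<rho> k = 1 - 1 / (real k + 2)" for k
  have \<rho>: "0 < \<rho> k" "\<rho> k < 1" for k by (auto simp: \<rho>_def field_simps)
  have "(\<lambda>k. 2 * pi * (\<Sum>n. (norm (\<rho> k ^ n *\<^sub>R a n))\<^sup>2)) \<longlonglongrightarrow> integral {0..2 * pi} (\<lambda>t. (norm (?L t))\<^sup>2)"
    unfolding \<rho>_def by (rule bounded_slice_limit(2)[OF f I le neg]) (use L in auto)
  moreover have "norm (?L t) = 1" for t
    using L[of t] by simp
  then have "integral {0..2 * pi} (\<lambda>t. (norm (?L t))\<^sup>2) = 2 * pi" by simp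
  ultimately have lim: "(\<lambda>k. 2 * pi * (\<Sum>n. (norm (\<rho> k ^ n *\<^sub>R a n))\<^sup>2)) \<longlonglongrightarrow> 2 * pi" by simp
  have "2 * pi \<le> 2 * pi * (\<Sum>n. (norm (a n))\<^sup>2)"
  proof (rule LIMSEQ_le_const2[OF lim], intro exI allI impI mult_left_mono)
    fix k
    show "(\<Sum>n. (norm (\<rho> k ^ n *\<^sub>R a n))\<^sup>2) \<le> (\<Sum>n. (norm (a n))\<^sup>2)"
      using f(2) \<rho>[of k]
      by (intro suminf_le norm_dilate_le summable_norm_square[OF summable_dilate])
        (auto simp: square_summable_def)
  qed simp
  then show "1 \<le> (\<Sum>n. (norm (a n))\<^sup>2)" by simp
qed

lemma unit_limits_of_sum_square_eq_1:
  assumes f: "power_series_on_ball f a" "square_summable a"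
    and le: "\<And>q. q \<in> \<bool> \<Longrightarrow> norm (f q) \<le> 1"
    and one: "(\<Sum>n. (norm (a n))\<^sup>2) = 1"
  shows "AE q in boundary_measure. \<exists>l. has_radial_limit f q l \<and> norm l = 1"
proof (rule AE_boundary_measureI[OF radial_limit_set_borel[OF f]])
  fix I assume I: "I \<in> imag_units"
  let ?N = "{t \<in> {0..2 * pi}. \<nexists>l. has_radial_limit f (qcis I t) l}"
  have neg: "negligible ?N"
    using fatou_radial_limits[OF I f(2)] by (simp add: slice_limit_iff[OF f(1) I])
  obtain L where L: "\<And>t. t \<in> {0..2 * pi} - ?N \<Longrightarrow> has_radial_limit f (qcis I t) (L t)"
    using bchoice[of "{0..2 * pi} - ?N" "\<lambda>t l. has_radial_limit f (qcis I t) l"] by blast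
  let ?L = "\<lambda>t. if t \<in> {0..2 * pi} - ?N then L t else 1"
  define \<rho> where "\<rho> k = 1 - 1 / (real k + 2)" for k
  have \<rho>: "0 < \<rho> k" "\<rho> k < 1" for k by (auto simp: \<rho>_def field_simps)
  have int: "(\<lambda>t. (norm (?L t))\<^sup>2) integrable_on {0..2 * pi}"
    and lim: "(\<lambda>k. 2 * pi * (\<Sum>n. (norm (\<rho> k ^ n *\<^sub>R a n))\<^sup>2)) \<longlonglongrightarrow> integral {0..2 * pi} (\<lambda>t. (norm (?L t))\<^sup>2)"
    unfolding \<rho>_def by (rule bounded_slice_limit[OF f I le neg]; use L in auto)+
  have L_le: "norm (?L t) \<le> 1" for t
  proof (cases "t \<in> {0..2 * pi} - ?N")
    case True
    have "norm (L t) \<le> 1"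
    proof (rule tendsto_upperbound)
      show "((\<lambda>s. norm (f (s *\<^sub>R qcis I t))) \<longlongrightarrow> norm (L t)) (at_left 1)"
        using L[OF True] unfolding has_radial_limit_def by (rule tendsto_norm)
      have "\<forall>\<^sub>F s in at_left (1::real). s \<in> {0<..<1}"
        by (rule eventually_at_left_real) simp
      then show "\<forall>\<^sub>F s in at_left 1. norm (f (s *\<^sub>R qcis I t)) \<le> 1"
        by eventually_elim (use le[OF slice_point_in_ball[OF I]] in auto)
    qed simp
    then show ?thesis using True by simp
  qed auto
  \<comment> \<open>Partial sums suffice for a lower bound of the limit of the circle means.\<close>
  have "2 * pi * (\<Sum>n<M. (norm (a n))\<^sup>2) \<le> integral {0..2 * pi} (\<lambda>t. (norm (?L t))\<^sup>2)" for M
  proof (rule LIMSEQ_le[OF _ lim])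
    have "\<rho> \<longlonglongrightarrow> 1 - 0"
      unfolding \<rho>_def
      by (intro tendsto_diff tendsto_const) (use LIMSEQ_ignore_initial_segment[OF lim_1_over_n[where 'a = real], of 2] in \<open>simp add: add.commute\<close>)
    then have "(\<lambda>k. 2 * pi * (\<Sum>n<M. (norm (\<rho> k ^ n *\<^sub>R a n))\<^sup>2)) \<longlonglongrightarrow> 2 * pi * (\<Sum>n<M. (norm ((1 - 0) ^ n *\<^sub>R a n))\<^sup>2)"
      by (intro tendsto_intros)
    then show "(\<lambda>k. 2 * pi * (\<Sum>n<M. (norm (\<rho> k ^ n *\<^sub>R a n))\<^sup>2)) \<longlonglongrightarrow> 2 * pi * (\<Sum>n<M. (norm (a n))\<^sup>2)"
      by simp
    show "\<exists>K. \<forall>k\<ge>K. 2 * pi * (\<Sum>n<M. (norm (\<rho> k ^ n *\<^sub>R a n))\<^sup>2) \<le> 2 * pi * (\<Sum>n. (norm (\<rho> k ^ n *\<^sub>R a n))\<^sup>2)"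
    proof (intro exI allI impI mult_left_mono)
      fix k
      show "(\<Sum>n<M. (norm (\<rho> k ^ n *\<^sub>R a n))\<^sup>2) \<le> (\<Sum>n. (norm (\<rho> k ^ n *\<^sub>R a n))\<^sup>2)"
        using \<rho>[of k] by (intro sum_le_suminf summable_norm_square summable_dilate f) auto
    qed simp
  qed
  moreover have "(\<lambda>M. 2 * pi * (\<Sum>n<M. (norm (a n))\<^sup>2)) \<longlonglongrightarrow> 2 * pi * 1"
    unfolding one[symmetric] using f(2) by (intro tendsto_intros summable_LIMSEQ) (simp add: square_summable_def)
  ultimately have ge: "2 * pi \<le> integral {0..2 * pi} (\<lambda>t. (norm (?L t))\<^sup>2)"
    by (intro LIMSEQ_le_const2) auto
  have "negligible {t \<in> {0..2 * pi}. 1 - (norm (?L t))\<^sup>2 \<noteq> 0}"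
  proof (rule negligible_of_integral_nonpos)
    show "(\<lambda>t. 1 - (norm (?L t))\<^sup>2) integrable_on {0..2 * pi}"
      by (intro Henstock_Kurzweil_Integration.integrable_diff int) (simp add: integrable_const_ivl)
    show "0 \<le> 1 - (norm (?L t))\<^sup>2" for t
      using L_le[of t] by (simp add: power_le_one)
    have "integral {0..2 * pi} (\<lambda>t. 1 - (norm (?L t))\<^sup>2) = 2 * pi - integral {0..2 * pi} (\<lambda>t. (norm (?L t))\<^sup>2)"
      using int by (subst Henstock_Kurzweil_Integration.integral_diff) (simp_all add: integrable_const_ivl)
    then show "integral {0..2 * pi} (\<lambda>t. 1 - (norm (?L t))\<^sup>2) \<le> 0" using ge by simp
  qed
  then have "negligible ({t \<in> {0..2 * pi}. 1 - (norm (?L t))\<^sup>2 \<noteq> 0} \<union> ?N)"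
    using neg by simp
  then show "negligible {t \<in> {0..2 * pi}. qcis I t \<notin> {q \<in> sphere 0 1. \<exists>l. has_radial_limit f q l \<and> norm l = 1}}"
  proof (rule negligible_subset, intro subsetI)
    fix t assume t: "t \<in> {t \<in> {0..2 * pi}. qcis I t \<notin> {q \<in> sphere 0 1. \<exists>l. has_radial_limit f q l \<and> norm l = 1}}"
    show "t \<in> {t \<in> {0..2 * pi}. 1 - (norm (?L t))\<^sup>2 \<noteq> 0} \<union> ?N"
    proof (rule ccontr)
      assume n: "\<not> ?thesis"
      then have "t \<in> {0..2 * pi} - ?N" using t by blast
      moreover have "1 - (norm (?L t))\<^sup>2 = 0" using n t by blast
      ultimately have "has_radial_limit f (qcis I t) (L t)" "norm (L t) = 1"
        using L[of t] power2_eq_imp_eq[of "norm (L t)" 1] by auto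
      then show False using t by (auto simp: norm_qcis[OF I])
    qed
  qed
qed simp

theorem theorem3p6:
  fixes f :: "quat \<Rightarrow> quat"
  assumes "f \<in> H2"
  shows "(inner_function f \<longleftrightarrow> f \<in> Hinf \<and> H2_norm f = 1 \<and> Hinf_norm f = 1) \<and>
    (inner_function f \<longleftrightarrow>
      H2_norm f = 1 \<and>
      (\<forall>(k::nat) (l::quat).
        H2_norm ((\<lambda>q. q ^ k + l) \<star> f) \<le> H2_norm (\<lambda>q. q ^ k + l)))"
proof -
  obtain a where f: "power_series_on_ball f a" "square_summable a" and reg: "slice_regular f"
    using assms by (auto simp: H2_def square_summable_def)
  have nf: "H2_norm f = 1 \<longleftrightarrow> (\<Sum>n. (norm (a n))\<^sup>2) = 1"
    by (simp add: H2_norm_def ps_coeffs_eq[OF f(1)])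
  let ?P = "(\<forall>q\<in>\<bool>. norm (f q) \<le> 1) \<and> (\<Sum>n. (norm (a n))\<^sup>2) = 1"
  have Hinf: "f \<in> Hinf" if "\<forall>q\<in>\<bool>. norm (f q) \<le> 1"
    using reg that unfolding Hinf_def bounded_iff by auto
  have i: "inner_function f \<longleftrightarrow> ?P"
    unfolding inner_function_def
    using sum_square_eq_1_of_unit_limits[OF f] unit_limits_of_sum_square_eq_1[OF f] Hinf by blast
  have ii: "f \<in> Hinf \<and> H2_norm f = 1 \<and> Hinf_norm f = 1 \<longleftrightarrow> ?P"
  proof
    assume h: "f \<in> Hinf \<and> H2_norm f = 1 \<and> Hinf_norm f = 1"
    then have "bounded (f ` \<bool>)" by (simp add: Hinf_def)
    then have "bdd_above ((\<lambda>q. norm (f q)) ` \<bool>)"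
      unfolding bounded_iff bdd_above_def by auto
    then have "norm (f q) \<le> 1" if "q \<in> \<bool>" for q
      using h that unfolding Hinf_norm_def by (metis cSUP_upper)
    then show ?P using h nf by blast
  next
    assume P: ?P
    have b: "bdd_above ((\<lambda>q. norm (f q)) ` \<bool>)"
      using P by (intro bdd_aboveI[of _ 1]) auto
    have "Hinf_norm f \<le> 1"
      unfolding Hinf_norm_def using P by (intro cSUP_least) auto
    moreover have up: "norm (f q) \<le> Hinf_norm f" if "q \<in> \<bool>" for q
      unfolding Hinf_norm_def using b that by (intro cSUP_upper)
    then have "1 \<le> (Hinf_norm f)\<^sup>2"
      using sum_square_le_of_bounded[OF f up] P by simp
    moreover have "0 \<le> Hinf_norm f"
      using up[of 0] norm_ge_zero[of "f 0"] by (simp del: norm_ge_zero)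
    ultimately have "Hinf_norm f = 1"
      using power_less_one_iff[of "Hinf_norm f" 2] by simp
    then show "f \<in> Hinf \<and> H2_norm f = 1 \<and> Hinf_norm f = 1"
      using P Hinf nf by blast
  qed
  have iii: "H2_norm f = 1 \<and> (\<forall>(k::nat) (l::quat). H2_norm ((\<lambda>q. q ^ k + l) \<star> f) \<le> H2_norm (\<lambda>q. q ^ k + l)) \<longleftrightarrow> ?P"
  proof
    assume h: "H2_norm f = 1 \<and> (\<forall>(k::nat) (l::quat). H2_norm ((\<lambda>q. q ^ k + l) \<star> f) \<le> H2_norm (\<lambda>q. q ^ k + l))"
    then have one: "(\<Sum>n. (norm (a n))\<^sup>2) = 1" using nf by blast
    have "l2_inner (shift k a) (\<lambda>n. l * a n) = 0" if "k > 0" for k l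
      using l2_orthogonal_of_contractive[OF f one _ that] h by blast
    then show ?P using norm_le_1_of_orthogonal[OF f one] one by blast
  next
    assume P: ?P
    then show "H2_norm f = 1 \<and> (\<forall>(k::nat) (l::quat). H2_norm ((\<lambda>q. q ^ k + l) \<star> f) \<le> H2_norm (\<lambda>q. q ^ k + l))"
      using star_binom_contractive[OF f] nf by blast
  qed
  show ?thesis unfolding i ii iii by blast
qed

end
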